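(* For every $n \ge 2$, the virtual twin group $VT_n$ is residually finite and Hopfian.
   Context: For $n\ge 2$, the virtual twin group $VT_n$ is the group with generators $s_1,\dots,s_{n-1},\rho_1,\dots,\rho_{n-1}$ and defining relations: $s_i^2=1$ and $\rho_i^2=1$ for $1\le i\le n-1$; $s_is_j=s_js_i$, $\rho_i\rho_j=\rho_j\rho_i$ and $\rho_is_j=s_j\rho_i$ for $|i-j|\ge 2$; $\rho_i\rho_{i+1}\rho_i=\rho_{i+1}\rho_i\rho_{i+1}$ and $\rho_i\rho_{i+1}s_i=s_{i+1}\rho_i\rho_{i+1}$ for $1\le i\le n-2$. *)

theory Defs
  imports "HOL-Algebra.Coset"
begin

text \<open>The letter \<open>(x, True)\<close> stands for the generator \<open>x\<close>, and \<open>(x, False)\<close> for its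
  formal inverse. A relation \<open>u = v\<close> is the pair of words \<open>(u, v)\<close>.\<close>

type_synonym 'a word = "('a \<times> bool) list"

definition words :: "'a set \<Rightarrow> 'a word set" where
  "words X = lists (X \<times> UNIV)"

inductive_set pres_cong :: "'a set \<Rightarrow> ('a word \<times> 'a word) set \<Rightarrow> ('a word \<times> 'a word) set"
  for X :: "'a set" and R :: "('a word \<times> 'a word) set"
where
  refl: "u \<in> words X \<Longrightarrow> (u, u) \<in> pres_cong X R"
| sym: "(u, v) \<in> pres_cong X R \<Longrightarrow> (v, u) \<in> pres_cong X R"
| trans: "(u, v) \<in> pres_cong X R \<Longrightarrow> (v, w) \<in> pres_cong X R \<Longrightarrow> (u, w) \<in> pres_cong X R"
| append: "(u, u') \<in> pres_cong X R \<Longrightarrow> (v, v') \<in> pres_cong X R \<Longrightarrow> (u @ v, u' @ v') \<in> pres_cong X R"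
| cancel: "x \<in> X \<Longrightarrow> ([(x, b), (x, \<not> b)], []) \<in> pres_cong X R"
| rel: "(u, v) \<in> R \<Longrightarrow> u \<in> words X \<Longrightarrow> v \<in> words X \<Longrightarrow> (u, v) \<in> pres_cong X R"

definition presented_group :: "'a set \<Rightarrow> ('a word \<times> 'a word) set \<Rightarrow> 'a word set monoid" where
  "presented_group X R =
    \<lparr> carrier = words X // pres_cong X R,
      mult = (\<lambda>A B. \<Union>u\<in>A. \<Union>v\<in>B. pres_cong X R `` {u @ v}),
      one = pres_cong X R `` {[]} \<rparr>"

lemma words_Nil [simp]: "[] \<in> words X"
  and words_Cons [simp]: "(x, b) # w \<in> words X \<longleftrightarrow> x \<in> X \<and> w \<in> words X"
  and words_append [simp]: "u @ v \<in> words X \<longleftrightarrow> u \<in> words X \<and> v \<in> words X"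
  by (auto simp: words_def)

lemma pres_cong_words: "(u, v) \<in> pres_cong X R \<Longrightarrow> u \<in> words X \<and> v \<in> words X"
  by (induction rule: pres_cong.induct) auto

lemma equiv_pres_cong: "equiv (words X) (pres_cong X R)"
proof (rule equivI)
  show "pres_cong X R \<subseteq> words X \<times> words X"
    using pres_cong_words by fast
  show "refl_on (words X) (pres_cong X R)"
    by (auto simp: refl_on_def intro: pres_cong.refl)
  show "sym_on UNIV (pres_cong X R)"
    by (rule symI) (rule pres_cong.sym)
  show "trans (pres_cong X R)"
    by (rule transI) (rule pres_cong.trans)
qed

lemma presented_group_mult:
  assumes "u \<in> words X" "v \<in> words X"
  shows "pres_cong X R `` {u} \<otimes>\<^bsub>presented_group X R\<^esub> pres_cong X R `` {v} = pres_cong X R `` {u @ v}"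
proof -
  have "pres_cong X R `` {u' @ v'} = pres_cong X R `` {u @ v}"
    if "(u, u') \<in> pres_cong X R" "(v, v') \<in> pres_cong X R" for u' v'
    using equiv_class_eq[OF equiv_pres_cong pres_cong.append[OF that]] by simp
  then show ?thesis
    using pres_cong.refl[OF assms(1), of R] pres_cong.refl[OF assms(2), of R]
    unfolding presented_group_def monoid.simps by blast
qed

lemma presented_group_carrierE:
  assumes "A \<in> carrier (presented_group X R)"
  obtains u where "u \<in> words X" "A = pres_cong X R `` {u}"
  using assms by (auto simp: presented_group_def elim: quotientE)

lemma presented_group_carrierI:
  "u \<in> words X \<Longrightarrow> pres_cong X R `` {u} \<in> carrier (presented_group X R)"
  by (auto simp: presented_group_def intro: quotientI)

lemma presented_group_one: "\<one>\<^bsub>presented_group X R\<^esub> = pres_cong X R `` {[]}"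
  by (simp add: presented_group_def)

definition word_inv :: "'a word \<Rightarrow> 'a word" where
  "word_inv w = rev (map (\<lambda>(x, b). (x, \<not> b)) w)"

lemma word_inv_words: "w \<in> words X \<Longrightarrow> word_inv w \<in> words X"
  by (induction w) (auto simp: word_inv_def)

lemma word_inv_cancel: "w \<in> words X \<Longrightarrow> (word_inv w @ w, []) \<in> pres_cong X R"
proof (induction w)
  case Nil
  then show ?case by (auto simp: word_inv_def intro: pres_cong.refl)
next
  case (Cons a w)
  obtain x b where a: "a = (x, b)" by (cases a)
  have x: "x \<in> X" and w: "w \<in> words X" using Cons.prems a by auto
  have "([(x, \<not> b), (x, b)], []) \<in> pres_cong X R"
    using pres_cong.cancel[OF x, of "\<not> b" R] by simp
  then have "(word_inv w @ ([(x, \<not> b), (x, b)] @ w), word_inv w @ ([] @ w)) \<in> pres_cong X R"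
    by (intro pres_cong.append pres_cong.refl word_inv_words w)
  then have "(word_inv (a # w) @ (a # w), word_inv w @ w) \<in> pres_cong X R"
    by (simp add: word_inv_def a)
  then show ?case using Cons.IH[OF w] pres_cong.trans by blast
qed

lemma group_presented_group: "group (presented_group X R)"
proof (rule groupI)
  let ?G = "presented_group X R"
  show "\<one>\<^bsub>?G\<^esub> \<in> carrier ?G"
    by (simp add: presented_group_one presented_group_carrierI)
  fix A assume "A \<in> carrier ?G"
  then obtain u where u: "u \<in> words X" "A = pres_cong X R `` {u}"
    by (rule presented_group_carrierE)
  show "\<one>\<^bsub>?G\<^esub> \<otimes>\<^bsub>?G\<^esub> A = A"
    using u by (simp add: presented_group_one presented_group_mult)
  have "pres_cong X R `` {word_inv u} \<otimes>\<^bsub>?G\<^esub> A = \<one>\<^bsub>?G\<^esub>"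
    using equiv_class_eq[OF equiv_pres_cong word_inv_cancel[OF u(1), of R]]
    by (simp add: u presented_group_mult word_inv_words presented_group_one)
  then show "\<exists>B\<in>carrier ?G. B \<otimes>\<^bsub>?G\<^esub> A = \<one>\<^bsub>?G\<^esub>"
    using presented_group_carrierI word_inv_words u(1) by blast
  fix B assume "B \<in> carrier ?G"
  then obtain v where v: "v \<in> words X" "B = pres_cong X R `` {v}"
    by (rule presented_group_carrierE)
  show "A \<otimes>\<^bsub>?G\<^esub> B \<in> carrier ?G"
    using u v by (simp add: presented_group_mult presented_group_carrierI)
  fix C assume "C \<in> carrier ?G"
  then obtain w where w: "w \<in> words X" "C = pres_cong X R `` {w}"
    by (rule presented_group_carrierE)
  show "A \<otimes>\<^bsub>?G\<^esub> B \<otimes>\<^bsub>?G\<^esub> C = A \<otimes>\<^bsub>?G\<^esub> (B \<otimes>\<^bsub>?G\<^esub> C)"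
    using u v w by (simp add: presented_group_mult)
qed

fun word_eval :: "('b, 'm) monoid_scheme \<Rightarrow> ('a \<Rightarrow> 'b) \<Rightarrow> 'a word \<Rightarrow> 'b" where
  "word_eval H f [] = \<one>\<^bsub>H\<^esub>"
| "word_eval H f ((x, b) # w) = (if b then f x else inv\<^bsub>H\<^esub> (f x)) \<otimes>\<^bsub>H\<^esub> word_eval H f w"

theorem presented_group_universal:
  assumes "group H" and f: "f \<in> X \<rightarrow> carrier H"
    and R: "\<And>u v. (u, v) \<in> R \<Longrightarrow> word_eval H f u = word_eval H f v"
  shows "\<exists>h\<in>hom (presented_group X R) H. \<forall>x\<in>X. h (pres_cong X R `` {[(x, True)]}) = f x"
proof -
  interpret H: group H by fact
  have cl: "word_eval H f w \<in> carrier H" if "w \<in> words X" for w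
    using that
  proof (induction w)
    case (Cons a w)
    then show ?case using f by (cases a) auto
  qed simp
  have app: "word_eval H f (u @ v) = word_eval H f u \<otimes>\<^bsub>H\<^esub> word_eval H f v"
    if "u \<in> words X" "v \<in> words X" for u v
    using that
  proof (induction u)
    case (Cons a u)
    then show ?case using f cl by (cases a) (auto simp: H.m_assoc Pi_iff)
  qed (simp add: cl)
  have resp: "word_eval H f u = word_eval H f v" if "(u, v) \<in> pres_cong X R" for u v
    using that
  proof (induction rule: pres_cong.induct)
    case (append u u' v v')
    then show ?case using app pres_cong_words by metis
  next
    case (cancel x b)
    then have "f x \<in> carrier H" using f by auto
    then show ?case by simp
  qed (auto simp: R)
  define h where "h A = word_eval H f (SOME u. u \<in> A)" for A
  have h: "h (pres_cong X R `` {u}) = word_eval H f u" if "u \<in> words X" for u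
  proof -
    have "u \<in> pres_cong X R `` {u}" using that by (auto intro: pres_cong.refl)
    then have "(SOME v. v \<in> pres_cong X R `` {u}) \<in> pres_cong X R `` {u}" by (rule someI)
    then show ?thesis unfolding h_def using resp by fastforce
  qed
  have "h \<in> hom (presented_group X R) H"
    by (rule homI; elim presented_group_carrierE) (simp_all add: h cl app presented_group_mult)
  moreover have "h (pres_cong X R `` {[(x, True)]}) = f x" if "x \<in> X" for x
    using that f by (auto simp: h Pi_iff)
  ultimately show ?thesis by blast
qed

datatype vt_gen = S nat | Rho nat

abbreviation s_letter :: "nat \<Rightarrow> vt_gen \<times> bool" (\<open>\<s>\<close>) where "\<s> i \<equiv> (S i, True)"
abbreviation rho_letter :: "nat \<Rightarrow> vt_gen \<times> bool" (\<open>\<rho>\<close>) where "\<rho> i \<equiv> (Rho i, True)"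

definition vt_gens :: "nat \<Rightarrow> vt_gen set" where
  "vt_gens n = S ` {1..n-1} \<union> Rho ` {1..n-1}"

definition vt_rels :: "nat \<Rightarrow> (vt_gen word \<times> vt_gen word) set" where
  "vt_rels n =
     {([\<s> i, \<s> i], []) | i. i \<in> {1..n-1}}
   \<union> {([\<rho> i, \<rho> i], []) | i. i \<in> {1..n-1}}
   \<union> {([\<s> i, \<s> j], [\<s> j, \<s> i]) | i j. i \<in> {1..n-1} \<and> j \<in> {1..n-1} \<and> \<bar>int i - int j\<bar> \<ge> 2}
   \<union> {([\<rho> i, \<rho> j], [\<rho> j, \<rho> i]) | i j. i \<in> {1..n-1} \<and> j \<in> {1..n-1} \<and> \<bar>int i - int j\<bar> \<ge> 2}
   \<union> {([\<rho> i, \<s> j], [\<s> j, \<rho> i]) | i j. i \<in> {1..n-1} \<and> j \<in> {1..n-1} \<and> \<bar>int i - int j\<bar> \<ge> 2}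
   \<union> {([\<rho> i, \<rho> (i+1), \<rho> i], [\<rho> (i+1), \<rho> i, \<rho> (i+1)]) | i. i \<in> {1..n-2}}
   \<union> {([\<rho> i, \<rho> (i+1), \<s> i], [\<s> (i+1), \<rho> i, \<rho> (i+1)]) | i. i \<in> {1..n-2}}"

definition virtual_twin_group :: "nat \<Rightarrow> vt_gen word set monoid" where
  "virtual_twin_group n = presented_group (vt_gens n) (vt_rels n)"

definition residually_finite :: "('a, 'm) monoid_scheme \<Rightarrow> bool" where
  "residually_finite G \<longleftrightarrow>
     (\<forall>g\<in>carrier G. g \<noteq> \<one>\<^bsub>G\<^esub> \<longrightarrow> (\<exists>N. N \<lhd> G \<and> finite (carrier (G Mod N)) \<and> g \<notin> N))"

definition hopfian :: "('a, 'm) monoid_scheme \<Rightarrow> bool" where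
  "hopfian G \<longleftrightarrow> (\<forall>f\<in>epi G G. f \<in> iso G G)"

end

theory Submission
  imports Defs "HOL-Algebra.Bij" "HOL-Algebra.Generated_Groups" "HOL-Combinatorics.Permutations"
begin

text \<open>
The virtual twin group is an extension of the symmetric group, generated by the \<open>\<rho>\<^sub>i\<close>, by the normal
closure of the \<open>s\<^sub>i\<close>. This kernel is generated by one involution for each ordered pair \<open>(a, b)\<close> of
distinct points, called a twist here: the conjugate of \<open>s\<^sub>1\<close> by a permutation that carries \<open>(1, 2)\<close> to
\<open>(a, b)\<close>. Two twists commute if their pairs are disjoint, so the kernel is a right-angled Coxeter
group. That twists are well defined is \<open>conj_word_eq\<close>; it rests on the Coxeter presentation of the
symmetric group (\<open>rho_word_faithful\<close>) and on the stabilizers found along the way. Consequently every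
element is a word in the \<open>\<rho>\<^sub>i\<close> followed by a product of twists (\<open>semidirect_form\<close>), and a shortest such
product is reduced: equal twists are never separated only by twists that commute with them
(\<open>twists_shorten\<close>).

Residual finiteness comes from a finite action made to measure for a reduced list of pairs. Give every
pair a counter, and let the counters start at zero. Reading the list should raise at each
step the counter of the current pair by one. The twist of \<open>p\<close> is therefore made to exchange two
neighbouring values \<open>l\<close> and \<open>l + 1\<close> of the counter of \<open>p\<close>, where \<open>l\<close> depends only on the counters of
the other pairs that meet \<open>p\<close>. Such exchanges are involutions, and those of disjoint pairs commute, so
all relations hold. The list being reduced, these other counters determine at which
occurrence of \<open>p\<close> the reading is, so \<open>l\<close> can be chosen to raise the counter at every step
(\<open>toggle_advances\<close>). After the whole list the counters hold the numbers of occurrences, so a nonempty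
list moves the initial state. Carrying a permutation along in the state extends this to an action of
the whole group (\<open>involutive_frame_act\<close>) that also detects the permutation.

The Hopfian property follows by Malcev's theorem that finitely generated residually finite groups are
Hopfian.
\<close>

section \<open>Finite quotients and the Hopfian property\<close>

lemma (in group_hom) finite_quotient_separates:
  assumes "finite (carrier H)" "h g \<noteq> \<one>\<^bsub>H\<^esub>"
  shows "\<exists>N. N \<lhd> G \<and> finite (carrier (G Mod N)) \<and> g \<notin> N"
proof (intro exI conjI)
  show "kernel G H h \<lhd> G" by (rule normal_kernel)
  show "g \<notin> kernel G H h" using assms(2) by (simp add: kernel_def)
  have "(\<lambda>X. the_elem (h ` X)) ` carrier (G Mod kernel G H h) \<subseteq> carrier H"
    using FactGroup_the_elem_mem by auto
  then show "finite (carrier (G Mod kernel G H h))"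
    using FactGroup_inj_on assms(1) by (meson finite_imageD finite_subset)
qed

lemma hom_eq_on_generate:
  assumes "group G" "group H" "\<phi> \<in> hom G H" "\<psi> \<in> hom G H"
    and A: "A \<subseteq> carrier G" and eq: "\<And>a. a \<in> A \<Longrightarrow> \<phi> a = \<psi> a"
    and g: "g \<in> generate G A"
  shows "\<phi> g = \<psi> g"
proof -
  interpret G: group G by fact
  interpret \<phi>: group_hom G H \<phi> by (simp add: assms group_hom_axioms_def group_hom_def)
  interpret \<psi>: group_hom G H \<psi> by (simp add: assms group_hom_axioms_def group_hom_def)
  show ?thesis
    using g
  proof induction
    case (eng a b)
    then show ?case using G.generate_in_carrier[OF A] by simp
  qed (use A eq in auto)
qed

text \<open>Functions on a carrier set are arbitrary off the carrier; extensionality picks one representative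
of each homomorphism, without which the set of homomorphisms could be infinite.\<close>

lemma finite_extensional_homs:
  assumes "group G" "group Q" "finite A" "A \<subseteq> carrier G" "generate G A = carrier G"
    and "finite (carrier Q)"
  shows "finite (hom G Q \<inter> extensional (carrier G))"
proof (rule finite_imageD)
  show "inj_on (\<lambda>\<phi>. restrict \<phi> A) (hom G Q \<inter> extensional (carrier G))"
  proof (rule inj_onI)
    fix \<phi> \<psi>
    assume hs: "\<phi> \<in> hom G Q \<inter> extensional (carrier G)" "\<psi> \<in> hom G Q \<inter> extensional (carrier G)"
      and eq: "restrict \<phi> A = restrict \<psi> A"
    have on_A: "\<phi> a = \<psi> a" if "a \<in> A" for a
      using eq that by (metis restrict_apply')
    have "\<phi> g = \<psi> g" if "g \<in> carrier G" for g
      by (rule hom_eq_on_generate[OF assms(1,2) _ _ assms(4) on_A]) (use hs that assms(5) in auto)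
    then show "\<phi> = \<psi>" using hs by (intro extensionalityI[of _ "carrier G"]) auto
  qed
  have "(\<lambda>\<phi>. restrict \<phi> A) ` (hom G Q \<inter> extensional (carrier G)) \<subseteq> A \<rightarrow>\<^sub>E carrier Q"
    using assms(4) by (auto simp: hom_def)
  then show "finite ((\<lambda>\<phi>. restrict \<phi> A) ` (hom G Q \<inter> extensional (carrier G)))"
    using assms(3,6) by (meson finite_PiE finite_subset)
qed

text \<open>Malcev's argument. Let \<open>f\<close> be a surjective endomorphism with \<open>f g = 1\<close>, and let \<open>Q\<close> be a finite
quotient. Precomposition with \<open>f\<close> is an injective self-map of the set of homomorphisms to \<open>Q\<close>.
That set is finite, because a homomorphism is determined by its values on the finitely many
generators; so every homomorphism to \<open>Q\<close> factors through \<open>f\<close> and kills \<open>g\<close>.\<close>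

theorem finitely_generated_residually_finite_imp_hopfian:
  assumes "group G" "finite A" "A \<subseteq> carrier G" "generate G A = carrier G"
    and rf: "residually_finite G"
  shows "hopfian G"
  unfolding hopfian_def
proof
  fix f assume f: "f \<in> epi G G"
  interpret G: group G by fact
  have f_hom: "f \<in> hom G G" and f_onto: "f ` carrier G = carrier G"
    using f by (auto simp: epi_def)
  interpret f: group_hom G G f using f_hom by unfold_locales
  have "g = \<one>\<^bsub>G\<^esub>" if g: "g \<in> carrier G" "f g = \<one>\<^bsub>G\<^esub>" for g
  proof (rule ccontr)
    assume "g \<noteq> \<one>\<^bsub>G\<^esub>"
    then obtain N where N: "N \<lhd> G" "finite (carrier (G Mod N))" "g \<notin> N"
      using rf g(1) unfolding residually_finite_def by blast
    interpret N: normal N G by fact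
    let ?Q = "G Mod N"
    let ?Homs = "hom G ?Q \<inter> extensional (carrier G)"
    let ?pre = "\<lambda>\<phi>. restrict (\<phi> \<circ> f) (carrier G)"
    interpret Q: group ?Q by (rule N.factorgroup_is_group)
    have fin: "finite ?Homs"
      by (rule finite_extensional_homs) (use assms N Q.group_axioms in auto)
    have into: "?pre ` ?Homs \<subseteq> ?Homs"
      by (auto simp: hom_def Pi_iff)
    have "inj_on ?pre ?Homs"
    proof (rule inj_onI)
      fix \<phi> \<psi> assume hs: "\<phi> \<in> ?Homs" "\<psi> \<in> ?Homs" and eq: "?pre \<phi> = ?pre \<psi>"
      have "\<phi> (f a) = \<psi> (f a)" if "a \<in> carrier G" for a
        using fun_cong[OF eq, of a] that by simp
      then have "\<phi> b = \<psi> b" if "b \<in> carrier G" for b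
        using that f_onto by (metis imageE)
      then show "\<phi> = \<psi>" using hs by (intro extensionalityI[of _ "carrier G"]) auto
    qed
    then have onto: "?pre ` ?Homs = ?Homs"
      using fin into by (simp add: endo_inj_surj)
    have "restrict (\<lambda>a. N #>\<^bsub>G\<^esub> a) (carrier G) \<in> ?Homs"
      using N.r_coset_hom_Mod by (auto simp: hom_def)
    then obtain \<phi> where \<phi>: "\<phi> \<in> ?Homs"
        and eq: "restrict (\<lambda>a. N #>\<^bsub>G\<^esub> a) (carrier G) = ?pre \<phi>"
      using onto by (metis (no_types, lifting) imageE)
    interpret \<phi>: group_hom G ?Q \<phi>
      using \<phi> by (simp add: G.group_axioms Q.group_axioms group_hom_axioms_def group_hom_def)
    \<comment> \<open>The quotient map is \<open>\<phi> \<circ> f\<close>, hence sends \<open>g\<close> to \<open>\<phi> 1 = 1\<close>.\<close>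
    have "N #>\<^bsub>G\<^esub> g = N"
      using fun_cong[OF eq, of g] g \<phi>.hom_one by simp
    then show False using N(3) G.rcos_self[OF g(1) N.subgroup_axioms] by simp
  qed
  then have "inj_on f (carrier G)"
    by (simp add: f.inj_on_one_iff)
  then show "f \<in> iso G G"
    using f_hom f_onto by (simp add: iso_def bij_betw_def)
qed

section \<open>Finite actions of presented groups\<close>

lemma generate_presented_group:
  "generate (presented_group X R) ((\<lambda>x. pres_cong X R `` {[(x, True)]}) ` X)
    = carrier (presented_group X R)"
proof
  let ?G = "presented_group X R"
  let ?c = "\<lambda>w. pres_cong X R `` {w}"
  let ?A = "(\<lambda>x. ?c [(x, True)]) ` X"
  interpret G: group ?G by (rule group_presented_group)
  have A: "?A \<subseteq> carrier ?G" by (auto intro: presented_group_carrierI)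
  show "generate ?G ?A \<subseteq> carrier ?G"
    using G.generate_in_carrier[OF A] by blast
  have letter: "?c [(x, b)] \<in> generate ?G ?A" if x: "x \<in> X" for x b
  proof (cases b)
    case True
    then show ?thesis using x by (auto intro: generate.incl)
  next
    case False
    have "?c [(x, False)] \<otimes>\<^bsub>?G\<^esub> ?c [(x, True)] = \<one>\<^bsub>?G\<^esub>"
      using x equiv_class_eq[OF equiv_pres_cong pres_cong.cancel[OF x, of False R]]
      by (simp add: presented_group_mult presented_group_one)
    then have "inv\<^bsub>?G\<^esub> ?c [(x, True)] = ?c [(x, False)]"
      using x by (intro G.inv_equality presented_group_carrierI) auto
    then show ?thesis using False x generate.inv[of "?c [(x, True)]" ?A ?G] by auto
  qed
  have "?c w \<in> generate ?G ?A" if "w \<in> words X" for w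
    using that
  proof (induction w)
    case Nil
    then show ?case using generate.one[of ?G ?A] by (simp add: presented_group_one)
  next
    case (Cons a w)
    obtain x b where a: "a = (x, b)" by (cases a)
    have "?c (a # w) = ?c [(x, b)] \<otimes>\<^bsub>?G\<^esub> ?c w"
      using Cons.prems a by (simp add: presented_group_mult)
    then show ?case using Cons letter a by (auto intro: generate.eng)
  qed
  then show "carrier ?G \<subseteq> generate ?G ?A"
    by (auto elim: presented_group_carrierE)
qed

text \<open>Words act from the left, so the last letter of a word is applied first. Signs can be
ignored because the actions below let each generator act as its own inverse.\<close>

definition run :: "('a \<Rightarrow> 's \<Rightarrow> 's) \<Rightarrow> 'a word \<Rightarrow> 's \<Rightarrow> 's" where
  "run act w = foldr (\<lambda>(x, _). act x) w"

lemma run_simps [simp]: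
  "run act [] \<sigma> = \<sigma>"
  "run act ((x, b) # w) \<sigma> = act x (run act w \<sigma>)"
  "run act (u @ v) \<sigma> = run act u (run act v \<sigma>)"
  by (simp_all add: run_def)

locale involutive_action =
  fixes X :: "'a set" and R :: "('a word \<times> 'a word) set"
    and \<Sigma> :: "'s set" and act :: "'a \<Rightarrow> 's \<Rightarrow> 's"
  assumes rels_words: "R \<subseteq> words X \<times> words X"
    and act_closed: "\<And>x \<sigma>. x \<in> X \<Longrightarrow> \<sigma> \<in> \<Sigma> \<Longrightarrow> act x \<sigma> \<in> \<Sigma>"
    and act_invol: "\<And>x \<sigma>. x \<in> X \<Longrightarrow> \<sigma> \<in> \<Sigma> \<Longrightarrow> act x (act x \<sigma>) = \<sigma>"
    and act_rel: "\<And>u v \<sigma>. (u, v) \<in> R \<Longrightarrow> \<sigma> \<in> \<Sigma> \<Longrightarrow> run act u \<sigma> = run act v \<sigma>"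
begin

lemma run_closed: "w \<in> words X \<Longrightarrow> \<sigma> \<in> \<Sigma> \<Longrightarrow> run act w \<sigma> \<in> \<Sigma>"
  by (induction w) (auto simp: act_closed)

lemma run_pres_cong:
  assumes "(u, v) \<in> pres_cong X R" "\<sigma> \<in> \<Sigma>"
  shows "run act u \<sigma> = run act v \<sigma>"
  using assms
proof (induction arbitrary: \<sigma> rule: pres_cong.induct)
  case (append u u' v v')
  then have "v' \<in> words X" using pres_cong_words by blast
  then show ?case using append by (simp add: run_closed)
qed (simp_all add: act_invol act_rel)

text \<open>The action is a homomorphism to the finite group of bijections of \<open>\<Sigma>\<close>; a word that moves a point
lies outside its kernel.\<close>

theorem finite_quotient_separates:
  assumes fin: "finite \<Sigma>" and w: "w \<in> words X" and \<sigma>: "\<sigma> \<in> \<Sigma>" and moved: "run act w \<sigma> \<noteq> \<sigma>"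
  shows "\<exists>N. N \<lhd> presented_group X R \<and> finite (carrier (presented_group X R Mod N))
           \<and> pres_cong X R `` {w} \<notin> N"
proof -
  let ?G = "presented_group X R"
  let ?H = "BijGroup \<Sigma>"
  let ?f = "\<lambda>x. restrict (act x) \<Sigma>"
  interpret G: group ?G by (rule group_presented_group)
  interpret H: group ?H by (rule group_BijGroup)
  have f: "?f x \<in> carrier ?H" if "x \<in> X" for x
  proof -
    have "bij_betw (act x) \<Sigma> \<Sigma>"
      by (rule bij_betw_byWitness[where f' = "act x"]) (use that act_closed act_invol in auto)
    then show ?thesis by (simp add: BijGroup_def Bij_def)
  qed
  have mult: "\<alpha> \<otimes>\<^bsub>?H\<^esub> \<beta> = compose \<Sigma> \<alpha> \<beta>" if "\<alpha> \<in> carrier ?H" "\<beta> \<in> carrier ?H" for \<alpha> \<beta>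
    using that by (simp add: BijGroup_def)
  have inv_f: "inv\<^bsub>?H\<^esub> ?f x = ?f x" if "x \<in> X" for x
  proof (rule H.inv_equality)
    have "?f x \<otimes>\<^bsub>?H\<^esub> ?f x = compose \<Sigma> (?f x) (?f x)"
      using that f by (intro mult)
    then show "?f x \<otimes>\<^bsub>?H\<^esub> ?f x = \<one>\<^bsub>?H\<^esub>"
      using that by (auto simp: compose_def BijGroup_def fun_eq_iff act_closed act_invol)
  qed (use that f in auto)
  have eval: "word_eval ?H ?f u = restrict (run act u) \<Sigma> \<and> word_eval ?H ?f u \<in> carrier ?H"
    if "u \<in> words X" for u
    using that
  proof (induction u)
    case Nil
    then show ?case using id_Bij[of \<Sigma>] by (auto simp: BijGroup_def restrict_def)
  next
    case (Cons a u)
    obtain x b where a: "a = (x, b)" by (cases a)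
    have x: "x \<in> X" and u: "u \<in> words X" using Cons.prems a by auto
    have "word_eval ?H ?f (a # u) = ?f x \<otimes>\<^bsub>?H\<^esub> word_eval ?H ?f u"
      using x a by (simp add: inv_f)
    moreover have "?f x \<otimes>\<^bsub>?H\<^esub> word_eval ?H ?f u = restrict (run act (a # u)) \<Sigma>"
    proof -
      have "?f x \<otimes>\<^bsub>?H\<^esub> word_eval ?H ?f u = compose \<Sigma> (?f x) (restrict (run act u) \<Sigma>)"
        using mult[OF f[OF x], of "word_eval ?H ?f u"] Cons.IH[OF u] by metis
      then show ?thesis using a u by (auto simp: compose_def fun_eq_iff run_closed)
    qed
    moreover have "?f x \<otimes>\<^bsub>?H\<^esub> word_eval ?H ?f u \<in> carrier ?H"
      using H.m_closed[OF f[OF x]] Cons.IH[OF u] by metis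
    ultimately show ?case by metis
  qed
  have "word_eval ?H ?f u = word_eval ?H ?f v" if "(u, v) \<in> R" for u v
    using eval[of u] eval[of v] that rels_words act_rel by (fastforce simp: fun_eq_iff)
  then obtain h where h: "h \<in> hom ?G ?H"
      and hx: "\<forall>x\<in>X. h (pres_cong X R `` {[(x, True)]}) = ?f x"
    using presented_group_universal[OF H.group_axioms, of ?f X R] f by blast
  interpret h: group_hom ?G ?H h using h by unfold_locales
  have h_word: "h (pres_cong X R `` {u}) = word_eval ?H ?f u" if "u \<in> words X" for u
    using that
  proof (induction u)
    case Nil
    then show ?case using h.hom_one by (simp add: presented_group_one)
  next
    case (Cons a u)
    obtain x b where a: "a = (x, b)" by (cases a)
    have x: "x \<in> X" and u: "u \<in> words X" using Cons.prems a by auto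
    let ?c = "\<lambda>w. pres_cong X R `` {w}"
    have carr: "?c [(x, b)] \<in> carrier ?G" "?c [(x, True)] \<in> carrier ?G" "?c u \<in> carrier ?G"
      using x u by (auto intro: presented_group_carrierI)
    have "h (?c [(x, b)]) = ?f x"
    proof (cases b)
      case False
      have "?c [(x, False)] \<otimes>\<^bsub>?G\<^esub> ?c [(x, True)] = \<one>\<^bsub>?G\<^esub>"
        using x equiv_class_eq[OF equiv_pres_cong pres_cong.cancel[OF x, of False R]]
        by (simp add: presented_group_mult presented_group_one)
      then have "inv\<^bsub>?G\<^esub> ?c [(x, True)] = ?c [(x, b)]"
        using carr False by (intro G.inv_equality) auto
      then show ?thesis using h.hom_inv[OF carr(2)] hx x inv_f by simp
    qed (use hx x in simp)
    moreover have "?c (a # u) = ?c [(x, b)] \<otimes>\<^bsub>?G\<^esub> ?c u"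
      using x u a by (simp add: presented_group_mult)
    moreover have "h (?c [(x, b)] \<otimes>\<^bsub>?G\<^esub> ?c u) = h (?c [(x, b)]) \<otimes>\<^bsub>?H\<^esub> h (?c u)"
      using carr by simp
    moreover have "word_eval ?H ?f (a # u) = ?f x \<otimes>\<^bsub>?H\<^esub> word_eval ?H ?f u"
      using x a by (simp add: inv_f)
    ultimately show ?case using Cons.IH[OF u] by metis
  qed
  have "h (pres_cong X R `` {w}) \<sigma> \<noteq> \<sigma>"
    using h_word[OF w] eval[OF w] moved \<sigma> by simp
  then have "h (pres_cong X R `` {w}) \<noteq> \<one>\<^bsub>?H\<^esub>"
    using \<sigma> by (auto simp: BijGroup_def)
  moreover have "finite (carrier ?H)"
  proof (rule finite_subset)
    show "carrier ?H \<subseteq> \<Sigma> \<rightarrow>\<^sub>E \<Sigma>"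
      by (auto simp: BijGroup_def Bij_def bij_betw_def PiE_def)
    show "finite (\<Sigma> \<rightarrow>\<^sub>E \<Sigma>)" using fin by (simp add: finite_PiE)
  qed
  ultimately show ?thesis by (rule h.finite_quotient_separates[rotated])
qed

end

section \<open>Words in the virtual twin generators\<close>

lemma vt_gens_iff [simp]:
  "S i \<in> vt_gens n \<longleftrightarrow> 1 \<le> i \<and> i < n"
  "Rho i \<in> vt_gens n \<longleftrightarrow> 1 \<le> i \<and> i < n"
  by (auto simp: vt_gens_def)

lemma vt_rels_words: "vt_rels n \<subseteq> words (vt_gens n) \<times> words (vt_gens n)"
  unfolding vt_rels_def by auto

abbreviation adj :: "nat \<Rightarrow> nat \<Rightarrow> nat" where
  "adj i \<equiv> Transposition.transpose i (Suc i)"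

text \<open>The homomorphism to the symmetric group that sends every \<open>s\<^sub>i\<close> to the identity and every \<open>\<rho>\<^sub>i\<close> to
the transposition of \<open>i\<close> and \<open>i + 1\<close>. Its kernel is the normal closure of the \<open>s\<^sub>i\<close>.\<close>

fun perm :: "vt_gen word \<Rightarrow> nat \<Rightarrow> nat" where
  "perm [] = id"
| "perm ((S i, b) # w) = perm w"
| "perm ((Rho i, b) # w) = adj i \<circ> perm w"

lemma perm_append: "perm (u @ v) = perm u \<circ> perm v"
  by (induction u rule: perm.induct) (simp_all add: comp_assoc)

lemma adj_commute: "\<bar>int i - int j\<bar> \<ge> 2 \<Longrightarrow> adj i \<circ> adj j = adj j \<circ> adj i"
  by (auto simp: fun_eq_iff Transposition.transpose_def)

lemma adj_braid: "adj i \<circ> (adj (Suc i) \<circ> adj i) = adj (Suc i) \<circ> (adj i \<circ> adj (Suc i))"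
  by (auto simp: fun_eq_iff Transposition.transpose_def)

lemma perm_cong:
  assumes "(u, v) \<in> pres_cong (vt_gens n) (vt_rels n)"
  shows "perm u = perm v"
  using assms
proof (induction rule: pres_cong.induct)
  case (cancel x b)
  then show ?case by (cases x) simp_all
next
  case (rel u v)
  then show ?case
    by (auto simp: vt_rels_def adj_commute adj_braid)
qed (simp_all add: perm_append)

lemma perm_permutes: "w \<in> words (vt_gens n) \<Longrightarrow> perm w permutes {1..n}"
proof (induction w rule: perm.induct)
  case (3 i b w)
  then show ?case unfolding perm.simps by (intro permutes_compose permutes_swap_id) auto
qed (auto simp: permutes_id)

abbreviation rho_word :: "nat list \<Rightarrow> vt_gen word" where
  "rho_word ks \<equiv> map (\<lambda>i. \<rho> i) ks"

lemma rho_word_words: "set ks \<subseteq> {1..m} \<Longrightarrow> m < n \<Longrightarrow> rho_word ks \<in> words (vt_gens n)"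
  by (induction ks) auto

text \<open>The words \<open>\<rho>\<^sub>m \<dots> \<rho>\<^sub>j\<close> for \<open>1 \<le> j \<le> m + 1\<close> represent the cosets of the stabilizer of \<open>m + 1\<close>: such a
word carries \<open>j\<close> to \<open>m + 1\<close>, and it is empty for \<open>j = m + 1\<close>.\<close>

abbreviation desc :: "nat \<Rightarrow> nat \<Rightarrow> nat list" where
  "desc m j \<equiv> rev [j..<Suc m]"

lemma perm_desc: "j \<le> Suc m \<Longrightarrow> perm (rho_word (desc m j)) j = Suc m"
proof (induction "Suc m - j" arbitrary: j)
  case (Suc d)
  have "[j..<Suc m] = j # [Suc j..<Suc m]" 
    using Suc by (intro upt_conv_Cons) auto
  then have "desc m j = desc m (Suc j) @ [j]" by simp
  then show ?case using Suc by (simp add: perm_append del: upt_Suc)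
qed simp

lemma perm_rho_word_fixes:
  "set ks \<subseteq> {1..<m} \<Longrightarrow> m < a \<Longrightarrow> perm (rho_word ks) a = a"
  by (induction ks) (auto simp: Transposition.transpose_def)

lemma perm_inj: "inj (perm w)"
  by (induction w rule: perm.induct) (simp_all only: perm.simps inj_on_id inj_compose inj_transpose)

locale virtual_twin =
  fixes n :: nat
begin

abbreviation vt_words :: "vt_gen word set" where
  "vt_words \<equiv> words (vt_gens n)"

definition vt_cong :: "vt_gen word \<Rightarrow> vt_gen word \<Rightarrow> bool" (infix \<open>\<approx>\<close> 50) where
  "u \<approx> v \<longleftrightarrow> (u, v) \<in> pres_cong (vt_gens n) (vt_rels n)"

lemma cong_refl: "u \<in> vt_words \<Longrightarrow> u \<approx> u"
  by (simp add: vt_cong_def pres_cong.refl)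

lemma cong_sym: "u \<approx> v \<Longrightarrow> v \<approx> u"
  by (simp add: vt_cong_def pres_cong.sym)

lemma cong_trans [trans]: "u \<approx> v \<Longrightarrow> v \<approx> w \<Longrightarrow> u \<approx> w"
  unfolding vt_cong_def by (rule pres_cong.trans)

lemma cong_words: "u \<approx> v \<Longrightarrow> u \<in> vt_words \<and> v \<in> vt_words"
  by (simp add: vt_cong_def pres_cong_words)

lemma cong_perm: "u \<approx> v \<Longrightarrow> perm u = perm v"
  by (simp add: vt_cong_def perm_cong)

lemma cong_context:
  "u \<approx> v \<Longrightarrow> a \<in> vt_words \<Longrightarrow> b \<in> vt_words \<Longrightarrow> a @ u @ b \<approx> a @ v @ b"
  unfolding vt_cong_def by (intro pres_cong.append pres_cong.refl)

lemma cong_rel: "(u, v) \<in> vt_rels n \<Longrightarrow> u \<approx> v"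
  unfolding vt_cong_def using vt_rels_words by (blast intro: pres_cong.rel)

lemma commute_concat:
  assumes "c \<in> vt_words" "\<And>w. w \<in> set ws \<Longrightarrow> w @ c \<approx> c @ w"
  shows "concat ws @ c \<approx> c @ concat ws"
  using assms(2)
proof (induction ws)
  case Nil
  then show ?case using assms(1) by (simp add: cong_refl)
next
  case (Cons w ws)
  have w: "w @ c \<approx> c @ w" and ws: "concat ws @ c \<approx> c @ concat ws"
    using Cons by simp_all
  have wds: "w \<in> vt_words" "concat ws \<in> vt_words"
    using cong_words[OF w] cong_words[OF ws] by simp_all
  have "w @ concat ws @ c \<approx> w @ c @ concat ws"
    using cong_context[OF ws wds(1) words_Nil] by simp
  also have "\<dots> \<approx> c @ w @ concat ws"
    using cong_context[OF w words_Nil wds(2)] by simp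
  finally show ?case by simp
qed

lemma rho_invol: "1 \<le> i \<Longrightarrow> i < n \<Longrightarrow> [\<rho> i, \<rho> i] \<approx> []"
  and s_invol: "1 \<le> i \<Longrightarrow> i < n \<Longrightarrow> [\<s> i, \<s> i] \<approx> []"
  by (rule cong_rel; force simp: vt_rels_def)+

lemma far_commute:
  assumes "1 \<le> i" "i < n" "1 \<le> j" "j < n" "Suc i < j \<or> Suc j < i"
  shows "[\<rho> i, \<rho> j] \<approx> [\<rho> j, \<rho> i]" "[\<rho> i, \<s> j] \<approx> [\<s> j, \<rho> i]" "[\<s> i, \<s> j] \<approx> [\<s> j, \<s> i]"
  by (rule cong_rel; use assms in \<open>force simp: vt_rels_def\<close>)+

lemma braid:
  assumes "1 \<le> i" "Suc i < n"
  shows "[\<rho> i, \<rho> (Suc i), \<rho> i] \<approx> [\<rho> (Suc i), \<rho> i, \<rho> (Suc i)]"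
    and "[\<rho> i, \<rho> (Suc i), \<s> i] \<approx> [\<s> (Suc i), \<rho> i, \<rho> (Suc i)]"
  by (rule cong_rel; use assms in \<open>force simp: vt_rels_def\<close>)+

lemma rho_word_commute:
  assumes "m < n" "set ks \<subseteq> {1..m}" "1 \<le> j" "j < n" "\<And>i. i \<in> set ks \<Longrightarrow> Suc i < j \<or> Suc j < i"
  shows "rho_word ks @ [\<rho> j] \<approx> [\<rho> j] @ rho_word ks"
    and "rho_word ks @ [\<s> j] \<approx> [\<s> j] @ rho_word ks"
proof -
  have i: "1 \<le> i" "i < n" if "i \<in> set ks" for i using that assms by auto
  have "concat (map (\<lambda>i. [\<rho> i]) ks) @ [\<rho> j] \<approx> [\<rho> j] @ concat (map (\<lambda>i. [\<rho> i]) ks)"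
    by (rule commute_concat) (use assms i far_commute in auto)
  then show "rho_word ks @ [\<rho> j] \<approx> [\<rho> j] @ rho_word ks" by simp
  have "concat (map (\<lambda>i. [\<rho> i]) ks) @ [\<s> j] \<approx> [\<s> j] @ concat (map (\<lambda>i. [\<rho> i]) ks)"
    by (rule commute_concat) (use assms i far_commute in auto)
  then show "rho_word ks @ [\<s> j] \<approx> [\<s> j] @ rho_word ks" by simp
qed

lemma rho_word_rev_cancel:
  assumes "m < n" "set ks \<subseteq> {1..m}"
  shows "rho_word (ks @ rev ks) \<approx> []"
  using assms(2)
proof (induction ks)
  case (Cons i ks)
  have w: "[\<rho> i] \<in> vt_words" using Cons.prems assms(1) by auto
  have "rho_word ((i # ks) @ rev (i # ks)) \<approx> [\<rho> i] @ [] @ [\<rho> i]"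
    using cong_context[OF Cons.IH w w] Cons.prems by simp
  also have "[\<rho> i] @ [] @ [\<rho> i] \<approx> []"
    using Cons.prems assms(1) rho_invol by simp
  finally show ?case .
qed (simp add: cong_refl)

section \<open>The symmetric group inside the virtual twin group\<close>

text \<open>The coset representatives are permuted by right multiplication with a generator, up to a word in
\<open>\<rho>\<^sub>1, \<dots>, \<rho>\<^sub>m\<^sub>-\<^sub>1\<close> on the left. For \<open>i = j\<close> a letter cancels, for \<open>i = j - 1\<close> the representative grows, a
smaller \<open>i\<close> commutes past all letters, and a larger \<open>i\<close> moves down to its neighbour \<open>i - 1\<close>, where
the braid relation turns it into \<open>i - 1\<close>, which then commutes with the remaining letters.\<close>

lemma desc_step:
  assumes m: "m < n" and i: "1 \<le> i" "i \<le> m" and j: "1 \<le> j" "j \<le> Suc m"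
  shows "\<exists>ks k. set ks \<subseteq> {1..<m} \<and> 1 \<le> k \<and> k \<le> Suc m
           \<and> rho_word (desc m j @ [i]) \<approx> rho_word (ks @ desc m k)"
proof -
  have in_words: "rho_word ks \<in> vt_words" if "set ks \<subseteq> {1..m}" for ks
    using rho_word_words that m by blast
  consider "i = j" | "Suc i = j" | "Suc i < j" | k where "i = Suc k" "j \<le> k"
    using i j by (metis Suc_lessI less_imp_Suc_add linorder_neqE_nat le_add1 add_Suc_right add.commute)
  then show ?thesis
  proof cases
    case 1
    have "[j..<Suc m] = j # [Suc j..<Suc m]" using i 1 by (intro upt_conv_Cons) auto
    then have "rho_word (desc m j @ [i]) = rho_word (desc m (Suc j)) @ [\<rho> j, \<rho> j] @ []"
      using 1 by (simp del: upt_Suc)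
    also have "\<dots> \<approx> rho_word (desc m (Suc j)) @ [] @ []"
    proof (rule cong_context[OF rho_invol])
      show "rho_word (desc m (Suc j)) \<in> vt_words" by (rule in_words) auto
    qed (use i m 1 in auto)
    finally show ?thesis using j i 1
      by (intro exI[of _ "[]"] exI[of _ "Suc j"]) simp
  next
    case 2
    have "[i..<Suc m] = i # [Suc i..<Suc m]" using i by (intro upt_conv_Cons) auto
    then have "desc m j @ [i] = desc m i" using 2 by simp
    moreover have "rho_word (desc m i) \<in> vt_words"
      by (rule in_words) (use i in auto)
    ultimately show ?thesis using i
      by (intro exI[of _ "[]"] exI[of _ i]) (simp add: cong_refl del: upt_Suc)
  next
    case 3
    have "rho_word (desc m j) @ [\<rho> i] \<approx> [\<rho> i] @ rho_word (desc m j)"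
      by (rule rho_word_commute[OF m]) (use i j m 3 in auto)
    then show ?thesis using i j 3
      by (intro exI[of _ "[i]"] exI[of _ j]) auto
  next
    case (4 k)
    let ?D = "rho_word (desc m (Suc (Suc k)))" and ?E = "rho_word (rev [j..<k])"
    have "[j..<Suc m] = [j..<k] @ [k, Suc k] @ [Suc (Suc k)..<Suc m]"
      using upt_add_eq_append[of j k "Suc m - k"] 4 i
      by (simp add: upt_conv_Cons del: upt_Suc)
    then have D: "rho_word (desc m j) = ?D @ [\<rho> (Suc k), \<rho> k] @ ?E" 
      by (simp del: upt_Suc)
    have "?D \<in> vt_words" "?E \<in> vt_words"
      by (rule in_words; use 4 i j in force)+
    then have DE: "?D \<in> vt_words" "?E \<in> vt_words" "[\<rho> k] \<in> vt_words" "[\<rho> (Suc k)] \<in> vt_words"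
      using 4 i j m by (simp_all del: upt_Suc)
    have "?E @ [\<rho> (Suc k)] \<approx> [\<rho> (Suc k)] @ ?E"
      by (rule rho_word_commute[OF m]) (use i j m 4 in auto)
    then have "(?D @ [\<rho> (Suc k), \<rho> k]) @ (?E @ [\<rho> (Suc k)]) @ []
        \<approx> (?D @ [\<rho> (Suc k), \<rho> k]) @ ([\<rho> (Suc k)] @ ?E) @ []"
      by (rule cong_context) (use DE in auto)
    then have "rho_word (desc m j @ [i]) \<approx> ?D @ [\<rho> (Suc k), \<rho> k, \<rho> (Suc k)] @ ?E"
      using D 4 by simp
    also have "?D @ [\<rho> (Suc k), \<rho> k, \<rho> (Suc k)] @ ?E \<approx> ?D @ [\<rho> k, \<rho> (Suc k), \<rho> k] @ ?E"
      by (rule cong_context[OF cong_sym[OF braid(1)]]) (use i j m 4 DE in auto)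
    also have "?D @ [\<rho> k, \<rho> (Suc k), \<rho> k] @ ?E = [] @ (?D @ [\<rho> k]) @ [\<rho> (Suc k), \<rho> k] @ ?E" 
      by simp
    also have "\<dots> \<approx> [] @ ([\<rho> k] @ ?D) @ [\<rho> (Suc k), \<rho> k] @ ?E"
      by (rule cong_context[OF rho_word_commute(1)[OF m]]) (use i j m 4 DE in auto)
    also have "\<dots> = rho_word ([k] @ desc m j)" using D by simp
    finally show ?thesis using 4 i j
      by (intro exI[of _ "[k]"] exI[of _ j]) auto
  qed
qed

lemma coset_normal_form:
  assumes m: "m < n" and "set ks \<subseteq> {1..m}"
  shows "\<exists>js k. set js \<subseteq> {1..<m} \<and> 1 \<le> k \<and> k \<le> Suc m \<and> rho_word ks \<approx> rho_word (js @ desc m k)"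
  using assms(2)
proof (induction ks rule: rev_induct)
  case Nil
  show ?case by (intro exI[of _ "[]"] exI[of _ "Suc m"]) (simp add: cong_refl)
next
  case (snoc i ks)
  then obtain js k where js: "set js \<subseteq> {1..<m}" "1 \<le> k" "k \<le> Suc m"
      "rho_word ks \<approx> rho_word (js @ desc m k)"
    by auto
  obtain js' k' where js': "set js' \<subseteq> {1..<m}" "1 \<le> k'" "k' \<le> Suc m"
      "rho_word (desc m k @ [i]) \<approx> rho_word (js' @ desc m k')"
    using desc_step[OF m, of i k] js snoc.prems by auto
  have wds: "rho_word js \<in> vt_words" "[\<rho> i] \<in> vt_words"
    using js m snoc.prems by (auto intro!: rho_word_words[of _ m])
  have "[] @ rho_word ks @ [\<rho> i] \<approx> [] @ rho_word (js @ desc m k) @ [\<rho> i]"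
    by (rule cong_context[OF js(4)]) (use wds in auto)
  also have "\<dots> = rho_word js @ rho_word (desc m k @ [i]) @ []" by simp
  also have "\<dots> \<approx> rho_word js @ rho_word (js' @ desc m k') @ []"
    by (rule cong_context[OF js'(4)]) (use wds in auto)
  finally show ?case using js js'
    by (intro exI[of _ "js @ js'"] exI[of _ k']) auto
qed

text \<open>In the coset normal form, the representative \<open>\<rho>\<^sub>m \<dots> \<rho>\<^sub>k\<close> carries \<open>k\<close> to \<open>m + 1\<close>, which the other factor
fixes. If the whole word fixes \<open>m + 1\<close>, injectivity forces \<open>k = m + 1\<close>, an empty representative.\<close>

lemma stabilizer_last:
  assumes m: "m < n" and ks_m: "set ks \<subseteq> {1..m}" and top: "perm (rho_word ks) (Suc m) = Suc m"
  shows "\<exists>js. set js \<subseteq> {1..<m} \<and> rho_word ks \<approx> rho_word js"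
proof -
  obtain js k where js: "set js \<subseteq> {1..<m}" "1 \<le> k" "k \<le> Suc m"
      "rho_word ks \<approx> rho_word (js @ desc m k)"
    using coset_normal_form[OF m ks_m] by blast
  have "perm (rho_word ks) k = perm (rho_word js) (Suc m)"
    using cong_perm[OF js(4)] js by (simp add: perm_append perm_desc del: upt_Suc)
  also have "\<dots> = Suc m" using js(1) by (intro perm_rho_word_fixes[of _ m]) auto
  finally have "k = Suc m" using top perm_inj by (metis injD)
  then show ?thesis using js by auto
qed

text \<open>This is the Coxeter presentation of the symmetric group: a word in the \<open>\<rho>\<^sub>i\<close> whose permutation is
the identity fixes all points, so it can be pushed into smaller and smaller symmetric groups.\<close>

theorem rho_word_faithful:
  assumes "m < n" "set ks \<subseteq> {1..m}" "perm (rho_word ks) = id"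
  shows "rho_word ks \<approx> []"
  using assms
proof (induction m arbitrary: ks)
  case 0
  then show ?case by (simp add: cong_refl)
next
  case (Suc m)
  obtain js where js: "set js \<subseteq> {1..<Suc m}" "rho_word ks \<approx> rho_word js"
    using stabilizer_last[OF Suc.prems(1,2)] Suc.prems(3) by auto
  have "rho_word js \<approx> []"
    using Suc.IH[of js] Suc.prems cong_perm[OF js(2)] js(1) by (auto simp: atLeastLessThanSuc_atLeastAtMost)
  then show ?case using js(2) cong_trans by blast
qed

text \<open>Composing \<open>\<pi>\<close> with the inverse of the coset representative that carries \<open>\<pi>\<^sup>-\<^sup>1 (m + 1)\<close> to \<open>m + 1\<close>
gives a permutation that fixes \<open>m + 1\<close>, which induction takes care of.\<close>

theorem rho_word_realizes:
  assumes "m < n" "\<pi> permutes {1..Suc m}"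
  shows "\<exists>ks. set ks \<subseteq> {1..m} \<and> perm (rho_word ks) = \<pi>"
  using assms
proof (induction m arbitrary: \<pi>)
  case 0
  then have "\<pi> = id" by (simp add: permutes_sing)
  then show ?case by (intro exI[of _ "[]"]) simp
next
  case (Suc m)
  let ?N = "Suc (Suc m)"
  obtain k where k: "k \<in> {1..?N}" "\<pi> k = ?N"
    using permutes_image[OF Suc.prems(2)] by (metis One_nat_def Suc_le_mono atLeastAtMost_iff imageE order_refl zero_le)
  let ?d = "desc (Suc m) k"
  have d: "set ?d \<subseteq> {1..Suc m}" using k by auto
  let ?\<delta> = "perm (rho_word ?d)" and ?\<delta>' = "perm (rho_word (rev ?d))"
  have inverse: "?\<delta> \<circ> ?\<delta>' = id" "?\<delta>' \<circ> ?\<delta> = id"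
    using cong_perm[OF rho_word_rev_cancel[OF Suc.prems(1), of ?d]]
      cong_perm[OF rho_word_rev_cancel[OF Suc.prems(1), of "rev ?d"]] d
    by (simp_all add: perm_append del: upt_Suc)
  have top: "?\<delta>' ?N = k"
    using perm_desc[of k "Suc m"] k fun_cong[OF inverse(2), of k] by (simp del: upt_Suc)
  have "\<pi> \<circ> ?\<delta>' permutes {1..Suc m}"
  proof (rule permutes_superset)
    show "\<pi> \<circ> ?\<delta>' permutes {1..?N}"
      by (intro permutes_compose Suc.prems perm_permutes rho_word_words[of _ "Suc m"]) (use d in auto)
    show "(\<pi> \<circ> ?\<delta>') x = x" if "x \<in> {1..?N} - {1..Suc m}" for x
    proof -
      have "x = ?N" using that by auto
      then show ?thesis using top k by (simp del: upt_Suc)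
    qed
  qed
  then obtain js where js: "set js \<subseteq> {1..m}" "perm (rho_word js) = \<pi> \<circ> ?\<delta>'"
    using Suc by (metis Suc_lessD)
  have "perm (rho_word (js @ ?d)) = \<pi> \<circ> (?\<delta>' \<circ> ?\<delta>)"
    using js(2) by (simp add: perm_append comp_assoc del: upt_Suc)
  then have "perm (rho_word (js @ ?d)) = \<pi>"
    using inverse(2) by simp
  then show ?case using js(1) d by (intro exI[of _ "js @ ?d"]) auto
qed

end

section \<open>The conjugates of the generators s\<close>

lemma permutes_extending:
  assumes "finite D" "T \<subseteq> D" "inj_on f T" "f ` T \<subseteq> D"
  shows "\<exists>\<pi>. \<pi> permutes D \<and> (\<forall>x\<in>T. \<pi> x = f x)"
proof -
  have fin: "finite T" using assms finite_subset by blast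
  have "card (D - T) = card (D - f ` T)"
    using assms fin by (simp add: card_Diff_subset card_image)
  then obtain g where g: "bij_betw g (D - T) (D - f ` T)"
    using assms(1) finite_same_card_bij by (meson finite_Diff)
  let ?\<pi> = "\<lambda>x. if x \<in> T then f x else if x \<in> D then g x else x"
  have "bij_betw ?\<pi> T (f ` T)"
    using assms(3) by (auto simp: bij_betw_def cong: inj_on_cong)
  moreover have "bij_betw ?\<pi> (D - T) (D - f ` T)"
    using g by (subst bij_betw_cong[of _ _ g]) auto
  ultimately have "bij_betw ?\<pi> (T \<union> (D - T)) (f ` T \<union> (D - f ` T))"
    by (rule bij_betw_combine) auto
  then have "bij_betw ?\<pi> D D"
    using assms by (simp add: Un_absorb1)
  then have "?\<pi> permutes D"
    by (rule bij_imp_permutes) (use assms in auto)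
  then show ?thesis by (intro exI[of _ ?\<pi>]) auto
qed

definition disj_pairs :: "nat \<times> nat \<Rightarrow> nat \<times> nat \<Rightarrow> bool" where
  "disj_pairs p q \<longleftrightarrow> {fst p, snd p} \<inter> {fst q, snd q} = {}"

definition ordered_pairs :: "nat \<Rightarrow> (nat \<times> nat) set" where
  "ordered_pairs n = {(a, b). a \<in> {1..n} \<and> b \<in> {1..n} \<and> a \<noteq> b}"

text \<open>Every \<open>\<rho>\<^sub>i\<close> is an involution, so the reversed word is the inverse and this is a conjugate of \<open>s\<^sub>i\<close>.\<close>

definition conj_word :: "nat list \<Rightarrow> nat \<Rightarrow> vt_gen word" where
  "conj_word ks i = rho_word ks @ [\<s> i] @ rho_word (rev ks)"

context virtual_twin
begin

lemma in_words: "set ks \<subseteq> {1..n-1} \<Longrightarrow> rho_word ks \<in> vt_words"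
  by (cases "n = 0") (auto intro!: rho_word_words[of ks "n - 1"])

lemma rho_cancel: "set ks \<subseteq> {1..n-1} \<Longrightarrow> rho_word ks @ rho_word (rev ks) \<approx> []"
  using rho_word_rev_cancel[of "n - 1" ks] cong_refl[OF words_Nil] by (cases "n - 1 < n") auto

lemma rho_cancel': "set ks \<subseteq> {1..n-1} \<Longrightarrow> rho_word (rev ks) @ rho_word ks \<approx> []"
  using rho_cancel[of "rev ks"] by simp

lemma perm_rev_cancel:
  assumes "set ks \<subseteq> {1..n-1}"
  shows "perm (rho_word (rev ks)) (perm (rho_word ks) x) = x"
  using fun_cong[OF cong_perm[OF rho_cancel'[OF assms]], of x] by (simp add: perm_append)

lemma conj_word_words: "set ks \<subseteq> {1..n-1} \<Longrightarrow> 1 \<le> i \<Longrightarrow> i < n \<Longrightarrow> conj_word ks i \<in> vt_words"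
  using in_words[of ks] in_words[of "rev ks"] by (simp add: conj_word_def)

lemma conj_word_cong:
  assumes "set ks \<subseteq> {1..n-1}" "[\<s> i] \<approx> conj_word ds j"
  shows "conj_word ks i \<approx> conj_word (ks @ ds) j"
  using cong_context[OF assms(2), of "rho_word ks" "rho_word (rev ks)"] in_words[of ks] in_words[of "rev ks"]
    assms(1)
  by (simp add: conj_word_def)

text \<open>The joint stabilizer of the points \<open>n - 1\<close> and \<open>n\<close> is generated by \<open>\<rho>\<^sub>1, \<dots>, \<rho>\<^sub>n\<^sub>-\<^sub>3\<close>, by the coset normal form
applied twice, and each of these commutes with \<open>s\<^sub>n\<^sub>-\<^sub>1\<close> by a defining relation.\<close>

lemma s_commute_stabilizer:
  assumes n: "2 \<le> n" and ks: "set ks \<subseteq> {1..n-1}"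
    and stab: "perm (rho_word ks) (n - 1) = n - 1" "perm (rho_word ks) n = n"
  shows "rho_word ks @ [\<s> (n-1)] \<approx> [\<s> (n-1)] @ rho_word ks"
proof -
  have Suc: "Suc (n - 1) = n" "Suc (n - 2) = n - 1" using n by auto
  obtain js where js: "set js \<subseteq> {1..<n-1}" "rho_word ks \<approx> rho_word js"
    using stabilizer_last[of "n - 1" ks] n ks stab Suc by auto
  have "perm (rho_word js) (n - 1) = n - 1" using cong_perm[OF js(2)] stab by simp
  then obtain ls where ls: "set ls \<subseteq> {1..<n-2}" "rho_word js \<approx> rho_word ls"
    using stabilizer_last[of "n - 2" js] n js(1) Suc by fastforce
  have eq: "rho_word ks \<approx> rho_word ls" using js(2) ls(2) by (rule cong_trans)
  have s: "[\<s> (n-1)] \<in> vt_words" using n by simp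
  have "rho_word ks @ [\<s> (n-1)] \<approx> rho_word ls @ [\<s> (n-1)]"
    using cong_context[OF eq words_Nil s] by simp
  also have "\<dots> \<approx> [\<s> (n-1)] @ rho_word ls"
  proof (rule rho_word_commute(2)[of "n - 1"])
    have "1 \<le> i \<and> i < n - 2" if "i \<in> set ls" for i using ls(1) that by auto
    then show "set ls \<subseteq> {1..n-1}" "\<And>i. i \<in> set ls \<Longrightarrow> Suc i < n - 1 \<or> Suc (n - 1) < i"
      by fastforce+
  qed (use n in auto)
  also have "\<dots> \<approx> [\<s> (n-1)] @ rho_word ks"
    using cong_context[OF cong_sym[OF eq] s words_Nil] by simp
  finally show ?thesis .
qed

lemma conj_word_last_eq:
  assumes n: "2 \<le> n" and ks: "set ks \<subseteq> {1..n-1}" and ls: "set ls \<subseteq> {1..n-1}"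
    and eq: "perm (rho_word ks) (n - 1) = perm (rho_word ls) (n - 1)"
      "perm (rho_word ks) n = perm (rho_word ls) n"
  shows "conj_word ks (n-1) \<approx> conj_word ls (n-1)"
proof -
  let ?s = "[\<s> (n-1)]"
  have wds: "rho_word ks \<in> vt_words" "rho_word (rev ks) \<in> vt_words"
    "rho_word ls \<in> vt_words" "rho_word (rev ls) \<in> vt_words" "?s \<in> vt_words"
    using in_words[of ks] in_words[of "rev ks"] in_words[of ls] in_words[of "rev ls"] ks ls n by auto
  have comm: "rho_word (rev ls @ ks) @ ?s \<approx> ?s @ rho_word (rev ls @ ks)"
    by (rule s_commute_stabilizer[OF n]) (use ks ls eq in \<open>auto simp: perm_append perm_rev_cancel\<close>)
  have "[] @ [] @ (rho_word ks @ ?s @ rho_word (rev ks))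
      \<approx> [] @ (rho_word ls @ rho_word (rev ls)) @ (rho_word ks @ ?s @ rho_word (rev ks))"
    by (rule cong_context[OF cong_sym[OF rho_cancel[OF ls]]]) (use wds in auto)
  also have "\<dots> = rho_word ls @ (rho_word (rev ls @ ks) @ ?s) @ rho_word (rev ks)"
    by simp
  also have "\<dots> \<approx> rho_word ls @ (?s @ rho_word (rev ls @ ks)) @ rho_word (rev ks)"
    by (rule cong_context[OF comm]) (use wds in auto)
  also have "\<dots> = (rho_word ls @ ?s @ rho_word (rev ls)) @ (rho_word ks @ rho_word (rev ks)) @ []"
    by simp
  also have "\<dots> \<approx> (rho_word ls @ ?s @ rho_word (rev ls)) @ [] @ []"
    by (rule cong_context[OF rho_cancel[OF ks]]) (use wds in auto)
  finally show ?thesis by (simp add: conj_word_def)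
qed

text \<open>The mixed relation says that \<open>s\<^sub>i\<close> is the conjugate of \<open>s\<^sub>i\<^sub>+\<^sub>1\<close> by \<open>\<rho>\<^sub>i\<^sub>+\<^sub>1 \<rho>\<^sub>i\<close>; iterating it reaches \<open>s\<^sub>n\<^sub>-\<^sub>1\<close>,
whose stabilizer is the easiest one to describe.\<close>

lemma s_as_conj_word:
  assumes "1 \<le> i" "i < n"
  shows "\<exists>ds. set ds \<subseteq> {1..n-1} \<and> [\<s> i] \<approx> conj_word ds (n-1)
    \<and> perm (rho_word ds) (n-1) = i \<and> perm (rho_word ds) n = Suc i"
  using assms
proof (induction "n - 1 - i" arbitrary: i)
  case 0
  then have "i = n - 1" by simp
  then show ?case using 0 by (intro exI[of _ "[]"]) (simp add: conj_word_def cong_refl)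
next
  case (Suc d)
  then have i: "1 \<le> i" "Suc i < n" by simp_all
  then obtain ds where ds: "set ds \<subseteq> {1..n-1}" "[\<s> (Suc i)] \<approx> conj_word ds (n-1)"
    "perm (rho_word ds) (n-1) = Suc i" "perm (rho_word ds) n = Suc (Suc i)"
    using Suc.hyps(1)[of "Suc i"] Suc.hyps(2) by fastforce
  have valid: "set [Suc i, i] \<subseteq> {1..n-1}" using i by auto
  have "[] @ [] @ [\<s> i] \<approx> [] @ (rho_word [Suc i, i] @ rho_word (rev [Suc i, i])) @ [\<s> i]"
    by (rule cong_context[OF cong_sym[OF rho_cancel[OF valid]]]) (use i in auto)
  also have "\<dots> = [\<rho> (Suc i), \<rho> i] @ [\<rho> i, \<rho> (Suc i), \<s> i] @ []" by simp
  also have "\<dots> \<approx> [\<rho> (Suc i), \<rho> i] @ [\<s> (Suc i), \<rho> i, \<rho> (Suc i)] @ []"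
    by (rule cong_context[OF braid(2)]) (use i in auto)
  also have "\<dots> = conj_word [Suc i, i] (Suc i)" by (simp add: conj_word_def)
  also have "\<dots> \<approx> conj_word ([Suc i, i] @ ds) (n-1)"
    by (rule conj_word_cong[OF valid ds(2)])
  finally show ?case using ds valid
    by (intro exI[of _ "[Suc i, i] @ ds"]) (auto simp: perm_append)
qed

text \<open>A conjugate of an \<open>s\<^sub>i\<close> depends only on the ordered pair of points to which the conjugating
permutation carries \<open>i\<close> and \<open>i + 1\<close>: after rewriting both sides as conjugates of \<open>s\<^sub>n\<^sub>-\<^sub>1\<close>, the two
conjugating words differ by an element of the stabilizer of \<open>n - 1\<close> and \<open>n\<close>.\<close>

theorem conj_word_eq:
  assumes ks: "set ks \<subseteq> {1..n-1}" and i: "1 \<le> i" "i < n"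
    and ls: "set ls \<subseteq> {1..n-1}" and j: "1 \<le> j" "j < n"
    and eq: "perm (rho_word ks) i = perm (rho_word ls) j"
      "perm (rho_word ks) (Suc i) = perm (rho_word ls) (Suc j)"
  shows "conj_word ks i \<approx> conj_word ls j"
proof -
  obtain ds where ds: "set ds \<subseteq> {1..n-1}" "[\<s> i] \<approx> conj_word ds (n-1)"
    "perm (rho_word ds) (n-1) = i" "perm (rho_word ds) n = Suc i"
    using s_as_conj_word[OF i] by blast
  obtain es where es: "set es \<subseteq> {1..n-1}" "[\<s> j] \<approx> conj_word es (n-1)"
    "perm (rho_word es) (n-1) = j" "perm (rho_word es) n = Suc j"
    using s_as_conj_word[OF j] by blast
  have "conj_word ks i \<approx> conj_word (ks @ ds) (n-1)" by (rule conj_word_cong[OF ks ds(2)])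
  also have "\<dots> \<approx> conj_word (ls @ es) (n-1)"
    by (rule conj_word_last_eq) (use ks ls ds es i eq in \<open>auto simp: perm_append\<close>)
  also have "\<dots> \<approx> conj_word ls j" by (rule cong_sym[OF conj_word_cong[OF ls es(2)]])
  finally show ?thesis .
qed

lemma conj_word_mult:
  assumes ks: "set ks \<subseteq> {1..n-1}" and i: "1 \<le> i" "i < n" and j: "1 \<le> j" "j < n"
  shows "conj_word ks i @ conj_word ks j \<approx> rho_word ks @ [\<s> i, \<s> j] @ rho_word (rev ks)"
proof -
  have wds: "rho_word ks \<in> vt_words" "rho_word (rev ks) \<in> vt_words"
    using in_words[of ks] in_words[of "rev ks"] ks by auto
  have "(rho_word ks @ [\<s> i]) @ (rho_word (rev ks) @ rho_word ks) @ ([\<s> j] @ rho_word (rev ks))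
      \<approx> (rho_word ks @ [\<s> i]) @ [] @ ([\<s> j] @ rho_word (rev ks))"
    by (rule cong_context[OF rho_cancel'[OF ks]]) (use wds i j in auto)
  then show ?thesis by (simp add: conj_word_def)
qed

lemma conj_word_invol:
  assumes ks: "set ks \<subseteq> {1..n-1}" and i: "1 \<le> i" "i < n"
  shows "conj_word ks i @ conj_word ks i \<approx> []"
proof -
  note conj_word_mult[OF ks i i]
  also have "rho_word ks @ [\<s> i, \<s> i] @ rho_word (rev ks) \<approx> rho_word ks @ [] @ rho_word (rev ks)"
    by (rule cong_context[OF s_invol[OF i]]) (use in_words[of ks] in_words[of "rev ks"] ks in auto)
  also have "rho_word ks @ [] @ rho_word (rev ks) \<approx> []" using rho_cancel[OF ks] by simp
  finally show ?thesis .
qed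

lemma conj_word_commute:
  assumes ks: "set ks \<subseteq> {1..n-1}" and i: "1 \<le> i" "i < n" and j: "1 \<le> j" "j < n"
    and far: "Suc i < j"
  shows "conj_word ks i @ conj_word ks j \<approx> conj_word ks j @ conj_word ks i"
proof -
  note conj_word_mult[OF ks i j]
  also have "rho_word ks @ [\<s> i, \<s> j] @ rho_word (rev ks) \<approx> rho_word ks @ [\<s> j, \<s> i] @ rho_word (rev ks)"
    by (rule cong_context[OF far_commute(3)])
      (use in_words[of ks] in_words[of "rev ks"] ks i j far in auto)
  also note cong_sym[OF conj_word_mult[OF ks j i]]
  finally show ?thesis .
qed

text \<open>The generator of the kernel attached to \<open>p\<close>. The order of the pair matters: \<open>s\<^sub>i\<close> belongs to
\<open>(i, i + 1)\<close>, and \<open>\<rho>\<^sub>i s\<^sub>i \<rho>\<^sub>i\<close> to \<open>(i + 1, i)\<close>. By \<open>conj_word_eq\<close> the choice of \<open>ks\<close> is immaterial in the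
group.\<close>

definition twist :: "nat \<times> nat \<Rightarrow> vt_gen word" where
  "twist p = conj_word (SOME ks. set ks \<subseteq> {1..n-1}
     \<and> perm (rho_word ks) 1 = fst p \<and> perm (rho_word ks) 2 = snd p) 1"

lemma rho_word_with_values:
  assumes "T \<subseteq> {1..n}" "inj_on f T" "f ` T \<subseteq> {1..n}"
  obtains ks where "set ks \<subseteq> {1..n-1}" "\<And>x. x \<in> T \<Longrightarrow> perm (rho_word ks) x = f x"
proof (cases "n = 0")
  case True
  then show ?thesis using that[of "[]"] assms by simp
next
  case False
  obtain \<pi> where "\<pi> permutes {1..n}" "\<forall>x\<in>T. \<pi> x = f x"
    using permutes_extending[OF finite_atLeastAtMost assms] by blast
  then show ?thesis using rho_word_realizes[of "n - 1" \<pi>] that False by auto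
qed

lemma twist_conj_word:
  assumes "p \<in> ordered_pairs n"
  obtains ks where "twist p = conj_word ks 1" "set ks \<subseteq> {1..n-1}"
    "perm (rho_word ks) 1 = fst p" "perm (rho_word ks) 2 = snd p" "1 < n"
proof -
  have n: "1 < n" using assms by (auto simp: ordered_pairs_def)
  obtain ls where ls: "set ls \<subseteq> {1..n-1}"
      "\<And>x. x \<in> {1,2} \<Longrightarrow> perm (rho_word ls) x = (if x = 1 then fst p else snd p)"
    by (rule rho_word_with_values[of "{1, 2}" "\<lambda>x. if x = 1 then fst p else snd p"])
      (use assms n in \<open>auto simp: ordered_pairs_def inj_on_def\<close>)
  let ?P = "\<lambda>ks. set ks \<subseteq> {1..n-1} \<and> perm (rho_word ks) 1 = fst p \<and> perm (rho_word ks) 2 = snd p"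
  have "?P ls" using ls by simp
  then have "?P (SOME ks. ?P ks)" by (rule someI)
  then show ?thesis using that[of "SOME ks. ?P ks"] n unfolding twist_def by blast
qed

lemma conj_word_twist:
  assumes ks: "set ks \<subseteq> {1..n-1}" and i: "1 \<le> i" "i < n"
  shows "conj_word ks i \<approx> twist (perm (rho_word ks) i, perm (rho_word ks) (Suc i))"
    and "(perm (rho_word ks) i, perm (rho_word ks) (Suc i)) \<in> ordered_pairs n"
proof -
  let ?p = "(perm (rho_word ks) i, perm (rho_word ks) (Suc i))"
  have "perm (rho_word ks) permutes {1..n}"
    by (rule perm_permutes[OF in_words[OF ks]])
  then have "perm (rho_word ks) i \<in> {1..n}" "perm (rho_word ks) (Suc i) \<in> {1..n}"
    using i permutes_in_image[of _ "{1..n}" i] permutes_in_image[of _ "{1..n}" "Suc i"] by auto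
  then show p: "?p \<in> ordered_pairs n"
    using injD[OF perm_inj, of "rho_word ks" i "Suc i"] by (auto simp: ordered_pairs_def)
  obtain ls where ls: "twist ?p = conj_word ls 1" "set ls \<subseteq> {1..n-1}"
    "perm (rho_word ls) 1 = fst ?p" "perm (rho_word ls) 2 = snd ?p" "1 < n"
    using twist_conj_word[OF p] by blast
  show "conj_word ks i \<approx> twist ?p"
    unfolding ls(1) by (rule conj_word_eq) (use ks i ls in \<open>auto simp: numeral_2_eq_2\<close>)
qed

lemma twist_words: "p \<in> ordered_pairs n \<Longrightarrow> twist p \<in> vt_words"
  by (erule twist_conj_word) (simp add: conj_word_words)

lemma twist_invol: "p \<in> ordered_pairs n \<Longrightarrow> twist p @ twist p \<approx> []"
  by (erule twist_conj_word) (simp add: conj_word_invol)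

text \<open>Some permutation carries \<open>1, 2, 3, 4\<close> to the four points of the two pairs. Conjugation by it turns
the statement into the defining relation that \<open>s\<^sub>1\<close> and \<open>s\<^sub>3\<close> commute.\<close>

lemma twist_commute:
  assumes p: "p \<in> ordered_pairs n" and q: "q \<in> ordered_pairs n" and "disj_pairs p q"
  shows "twist p @ twist q \<approx> twist q @ twist p"
proof -
  obtain a b c d where abcd: "p = (a, b)" "q = (c, d)" by (metis surj_pair)
  let ?f = "\<lambda>x::nat. if x = 1 then a else if x = 2 then b else if x = 3 then c else d"
  have dist: "distinct [a, b, c, d]" and sub: "{a, b, c, d} \<subseteq> {1..n}"
    using assms abcd by (auto simp: ordered_pairs_def disj_pairs_def)
  have "card {a, b, c, d} = 4" using dist by simp
  then have n: "4 \<le> n" using card_mono[OF finite_atLeastAtMost sub] by simp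
  obtain ks where ks: "set ks \<subseteq> {1..n-1}" "\<And>x. x \<in> {1, 2, 3, 4} \<Longrightarrow> perm (rho_word ks) x = ?f x"
    by (rule rho_word_with_values[of "{1, 2, 3, 4}" ?f]) (use dist sub n in \<open>auto simp: inj_on_def\<close>)
  have vals: "perm (rho_word ks) (Suc 0) = a" "perm (rho_word ks) (Suc (Suc 0)) = b"
      "perm (rho_word ks) 3 = c" "perm (rho_word ks) (Suc 3) = d"
    using ks(2)[of 1] ks(2)[of 2] ks(2)[of 3] ks(2)[of 4] by (simp_all add: numeral_2_eq_2)
  have P: "conj_word ks 1 \<approx> twist p" and Q: "conj_word ks 3 \<approx> twist q"
    using conj_word_twist(1)[OF ks(1), of 1] conj_word_twist(1)[OF ks(1), of 3] vals n abcd
    by simp_all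
  have both: "u @ v \<approx> u' @ v'" if "u \<approx> u'" "v \<approx> v'" for u v u' v'
    using that unfolding vt_cong_def by (rule pres_cong.append)
  have "twist p @ twist q \<approx> conj_word ks 1 @ conj_word ks 3"
    by (intro both cong_sym[OF P] cong_sym[OF Q])
  also have "\<dots> \<approx> conj_word ks 3 @ conj_word ks 1"
    by (rule conj_word_commute) (use ks n in auto)
  also have "\<dots> \<approx> twist q @ twist p" by (intro both P Q)
  finally show ?thesis .
qed

text \<open>Words act from the left, so the list is reversed to make its head the pair that acts first.\<close>

definition twists :: "(nat \<times> nat) list \<Rightarrow> vt_gen word" where
  "twists ps = concat (map twist (rev ps))"

lemma twists_words: "set ps \<subseteq> ordered_pairs n \<Longrightarrow> twists ps \<in> vt_words"
  by (induction ps rule: rev_induct) (simp_all add: twists_def twist_words)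

lemma letter_sign:
  assumes "x \<in> vt_gens n"
  shows "[(x, b)] \<approx> [(x, True)]"
proof (cases b)
  case False
  have invol: "[(x, True), (x, True)] \<approx> []"
    using assms by (cases x) (simp_all add: s_invol rho_invol)
  have "[(x, False)] @ [] @ [] \<approx> [(x, False)] @ [(x, True), (x, True)] @ []"
    by (rule cong_context[OF cong_sym[OF invol]]) (use assms in auto)
  also have "\<dots> = [] @ [(x, False), (x, True)] @ [(x, True)]" by simp
  also have "\<dots> \<approx> [] @ [] @ [(x, True)]"
    by (rule cong_context) (use assms pres_cong.cancel[of x "vt_gens n" False] in \<open>auto simp: vt_cong_def\<close>)
  finally show ?thesis using False by simp
qed (use assms in \<open>simp add: cong_refl\<close>)

text \<open>The letters \<open>\<rho>\<^sub>i\<close> are collected on the left. Moving \<open>s\<^sub>i\<close> to the right past a word in the \<open>\<rho>\<^sub>j\<close>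
conjugates it, and the conjugate is again a twist.\<close>

theorem semidirect_form:
  assumes "w \<in> vt_words"
  shows "\<exists>ks ps. set ks \<subseteq> {1..n-1} \<and> set ps \<subseteq> ordered_pairs n \<and> w \<approx> rho_word ks @ twists ps"
  using assms
proof (induction w)
  case Nil
  show ?case by (intro exI[of _ "[]"]) (simp add: twists_def cong_refl)
next
  case (Cons l w)
  obtain x b where l: "l = (x, b)" by (cases l)
  have x: "x \<in> vt_gens n" and w: "w \<in> vt_words" using Cons.prems l by auto
  obtain ks ps where ks: "set ks \<subseteq> {1..n-1}" and ps: "set ps \<subseteq> ordered_pairs n"
    and eq: "w \<approx> rho_word ks @ twists ps"
    using Cons.IH[OF w] by blast
  have wds: "rho_word ks \<in> vt_words" "twists ps \<in> vt_words"
    using in_words[OF ks] twists_words[OF ps] by auto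
  have "[] @ [(x, b)] @ w \<approx> [] @ [(x, True)] @ w"
    by (rule cong_context[OF letter_sign[OF x]]) (use w in auto)
  also have "\<dots> = [(x, True)] @ w @ []" by simp
  also have "\<dots> \<approx> [(x, True)] @ (rho_word ks @ twists ps) @ []"
    by (rule cong_context[OF eq]) (use x in auto)
  finally have lw: "l # w \<approx> (x, True) # rho_word ks @ twists ps" using l by simp
  show ?case
  proof (cases x)
    case (Rho i)
    then show ?thesis using lw ks ps x
      by (intro exI[of _ "i # ks"] exI[of _ ps]) auto
  next
    case (S i)
    then have i: "1 \<le> i" "i < n" using x by auto
    have rks: "set (rev ks) \<subseteq> {1..n-1}" using ks by simp
    let ?q = "(perm (rho_word (rev ks)) i, perm (rho_word (rev ks)) (Suc i))"
    note lw
    also have "(x, True) # rho_word ks @ twists ps = [] @ [] @ [\<s> i] @ rho_word ks @ twists ps"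
      using S by simp
    also have "\<dots> \<approx> [] @ (rho_word ks @ rho_word (rev ks)) @ [\<s> i] @ rho_word ks @ twists ps"
      by (rule cong_context[OF cong_sym[OF rho_cancel[OF ks]]]) (use wds i in auto)
    also have "\<dots> = rho_word ks @ conj_word (rev ks) i @ twists ps" by (simp add: conj_word_def)
    also have "\<dots> \<approx> rho_word ks @ twist ?q @ twists ps"
      by (rule cong_context[OF conj_word_twist(1)[OF rks i]]) (use wds in auto)
    also have "\<dots> = rho_word ks @ twists (ps @ [?q])" by (simp add: twists_def)
    finally show ?thesis using ks ps conj_word_twist(2)[OF rks i]
      by (intro exI[of _ ks] exI[of _ "ps @ [?q]"]) auto
  qed
qed

lemma twists_shorten:
  assumes ps: "set (A @ p # B @ p # C) \<subseteq> ordered_pairs n"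
    and B: "\<And>q. q \<in> set B \<Longrightarrow> q = p \<or> disj_pairs p q"
  shows "twists (A @ p # B @ p # C) \<approx> twists (A @ B @ C)"
proof -
  have p: "p \<in> ordered_pairs n" using ps by simp
  have wds: "twists A \<in> vt_words" "twists B \<in> vt_words" "twists C \<in> vt_words" "twist p \<in> vt_words"
    using ps by (auto intro!: twists_words twist_words)
  have "w @ twist p \<approx> twist p @ w" if "w \<in> set (map twist (rev B))" for w
  proof -
    obtain q where q: "q \<in> set B" "w = twist q"
      using \<open>w \<in> _\<close> unfolding set_map set_rev by blast
    then show ?thesis
      using B[OF q(1)] cong_sym[OF twist_commute[OF p, of q]] ps wds by (auto simp: cong_refl)
  qed
  then have comm: "twists B @ twist p \<approx> twist p @ twists B"
    unfolding twists_def by (intro commute_concat wds)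
  have "twists (A @ p # B @ p # C) = (twists C @ twist p) @ (twists B @ twist p) @ twists A"
    by (simp add: twists_def)
  also have "\<dots> \<approx> (twists C @ twist p) @ (twist p @ twists B) @ twists A"
    by (rule cong_context[OF comm]) (use wds in auto)
  also have "\<dots> = twists C @ (twist p @ twist p) @ twists B @ twists A" by simp
  also have "\<dots> \<approx> twists C @ [] @ twists B @ twists A"
    by (rule cong_context[OF twist_invol[OF p]]) (use wds in auto)
  also have "\<dots> = twists (A @ B @ C)" by (simp add: twists_def)
  finally show ?thesis .
qed

end

section \<open>Counting along a reduced word\<close>

text \<open>No two equal entries can be brought together, and hence cancelled, by exchanging commuting
neighbours. This is the usual criterion for a reduced word in a right-angled Coxeter group.\<close>

definition reduced :: "(nat \<times> nat) list \<Rightarrow> bool" where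
  "reduced ps \<longleftrightarrow> (\<forall>A p B C. ps = A @ p # B @ p # C \<longrightarrow> (\<exists>q\<in>set B. q \<noteq> p \<and> \<not> disj_pairs p q))"

text \<open>The counters \<open>v\<close> look like those of a run along \<open>ps\<close> that is about to apply \<open>p\<close> at position \<open>j\<close>. Only
counters of pairs that meet \<open>p\<close> are compared, and not that of \<open>p\<close> itself: so a change of the
counter of \<open>p\<close> or of a pair disjoint from \<open>p\<close> does not affect which positions match, which is what
makes \<open>toggle\<close> below an involution and lets toggles of disjoint pairs commute.\<close>

definition step_at :: "(nat \<times> nat) list \<Rightarrow> nat \<times> nat \<Rightarrow> (nat \<times> nat \<Rightarrow> nat) \<Rightarrow> nat \<Rightarrow> bool" where
  "step_at ps p v j \<longleftrightarrow> j < length ps \<and> ps ! j = p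
     \<and> (\<forall>q. q \<noteq> p \<and> \<not> disj_pairs p q \<longrightarrow> v q = count_list (take j ps) q)"

text \<open>If no position \<open>j\<close> qualifies, the choice of \<open>j\<close> is arbitrary, but it still depends only on the counters
of the other pairs that meet \<open>p\<close>, and the count of \<open>p\<close> in a prefix is still at most the length of \<open>ps\<close>.\<close>

definition level :: "(nat \<times> nat) list \<Rightarrow> nat \<times> nat \<Rightarrow> (nat \<times> nat \<Rightarrow> nat) \<Rightarrow> nat" where
  "level ps p v = count_list (take (SOME j. step_at ps p v j) ps) p"

definition toggle :: "(nat \<times> nat) list \<Rightarrow> nat \<times> nat \<Rightarrow> (nat \<times> nat \<Rightarrow> nat) \<Rightarrow> nat \<times> nat \<Rightarrow> nat" where
  "toggle ps p v = v(p := Transposition.transpose (level ps p v) (Suc (level ps p v)) (v p))"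

lemma disj_pairs_sym: "disj_pairs p q \<longleftrightarrow> disj_pairs q p"
  by (auto simp: disj_pairs_def)

lemma not_disj_pairs_refl [simp]: "\<not> disj_pairs p p"
  by (simp add: disj_pairs_def)

lemma level_cong:
  assumes "\<And>q. q \<noteq> p \<Longrightarrow> \<not> disj_pairs p q \<Longrightarrow> v q = v' q"
  shows "level ps p v = level ps p v'"
proof -
  have "step_at ps p v = step_at ps p v'"
    using assms by (auto simp: step_at_def fun_eq_iff)
  then show ?thesis by (simp add: level_def)
qed

lemma toggle_invol: "toggle ps p (toggle ps p v) = v"
proof -
  have "level ps p (toggle ps p v) = level ps p v"
    by (rule level_cong) (simp add: toggle_def)
  then show ?thesis by (simp add: toggle_def fun_eq_iff)
qed

lemma toggle_commute:
  assumes "disj_pairs p q"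
  shows "toggle ps p (toggle ps q v) = toggle ps q (toggle ps p v)"
proof -
  have neq: "p \<noteq> q" using assms by auto
  have "level ps p (toggle ps q v) = level ps p v"
    by (rule level_cong) (use assms in \<open>auto simp: toggle_def\<close>)
  moreover have "level ps q (toggle ps p v) = level ps q v"
    by (rule level_cong) (use assms disj_pairs_sym in \<open>auto simp: toggle_def\<close>)
  ultimately show ?thesis using neq by (auto simp: toggle_def fun_eq_iff)
qed

lemma level_le: "level ps p v \<le> length ps"
proof -
  have "count_list (take j ps) p \<le> length ps" for j
    using count_le_length[of "take j ps" p] by simp
  then show ?thesis by (simp add: level_def)
qed

text \<open>Between two occurrences of \<open>p\<close> in a reduced list some other pair occurs that does not commute with
\<open>p\<close>, so its counter tells the two positions apart.\<close>

lemma reduced_step_unique: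
  assumes red: "reduced ps" and ij: "i < j" "j < length ps" "ps ! i = p" "ps ! j = p"
    and same: "\<And>q. q \<noteq> p \<Longrightarrow> \<not> disj_pairs p q \<Longrightarrow> count_list (take i ps) q = count_list (take j ps) q"
  shows False
proof -
  define B where "B = drop (Suc i) (take j ps)"
  have "take j ps = take i (take j ps) @ take j ps ! i # drop (Suc i) (take j ps)"
    by (rule id_take_nth_drop) (use ij in simp)
  then have j: "take j ps = take i ps @ p # B"
    using ij by (simp add: B_def)
  have "ps = take i ps @ p # B @ p # drop (Suc j) ps"
    using id_take_nth_drop[OF ij(2)] ij(4) j by simp
  then obtain q where q: "q \<in> set B" "q \<noteq> p" "\<not> disj_pairs p q"
    using red unfolding reduced_def by blast
  then have "count_list B q = 0" using same[of q] j by simp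
  then show False using q(1) by (simp add: count_list_0_iff)
qed

text \<open>At the counters reached after \<open>j\<close> steps, position \<open>j\<close> is the only one that matches, so the level is the
current value of the counter and the toggle increases it by one.\<close>

lemma toggle_advances:
  assumes red: "reduced ps" and j: "j < length ps"
  shows "toggle ps (ps ! j) (count_list (take j ps)) = count_list (take (Suc j) ps)"
proof -
  let ?v = "count_list (take j ps)"
  have "step_at ps (ps ! j) ?v j" using j by (simp add: step_at_def)
  moreover have "i = j" if "step_at ps (ps ! j) ?v i" for i
  proof (rule linorder_cases)
    have i: "i < length ps" "ps ! i = ps ! j"
        "\<And>q. q \<noteq> ps ! j \<Longrightarrow> \<not> disj_pairs (ps ! j) q \<Longrightarrow> ?v q = count_list (take i ps) q"
      using that unfolding step_at_def by blast+
    show ?thesis if "i < j"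
      using reduced_step_unique[OF red that j i(2) HOL.refl] i(3) by simp
    show ?thesis if "j < i"
      using reduced_step_unique[OF red that i(1) HOL.refl i(2)] i(3) by simp
  qed
  ultimately have "(SOME i. step_at ps (ps ! j) ?v i) = j" by (rule some_equality)
  then have "level ps (ps ! j) ?v = ?v (ps ! j)" by (simp add: level_def)
  then show ?thesis
    using j by (auto simp: toggle_def fun_eq_iff take_Suc_conv_app_nth)
qed

lemma fold_toggle:
  assumes "reduced ps"
  shows "fold (toggle ps) ps (\<lambda>_. 0) = count_list ps"
proof -
  have "fold (toggle ps) (take j ps) (\<lambda>_. 0) = count_list (take j ps)" if "j \<le> length ps" for j
    using that
  proof (induction j)
    case (Suc j)
    then show ?case using toggle_advances[OF assms, of j]
      by (simp add: take_Suc_conv_app_nth)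
  qed (simp add: fun_eq_iff)
  from this[of "length ps"] show ?thesis by simp
qed

text \<open>The condition off the ordered pairs makes this a finite set of total functions.\<close>

definition counters :: "nat \<Rightarrow> nat \<Rightarrow> (nat \<times> nat \<Rightarrow> nat) set" where
  "counters n k = {v. \<forall>q. (q \<in> ordered_pairs n \<longrightarrow> v q \<in> {..k}) \<and> (q \<notin> ordered_pairs n \<longrightarrow> v q = 0)}"

lemma finite_counters: "finite (counters n k)"
  unfolding counters_def
proof (rule finite_set_of_finite_funs)
  have "ordered_pairs n \<subseteq> {1..n} \<times> {1..n}" by (auto simp: ordered_pairs_def)
  then show "finite (ordered_pairs n)" by (rule finite_subset) simp
qed simp

text \<open>The bound is \<open>length ps + 1\<close> because a level may equal \<open>length ps\<close> and the toggle reaches one above it.\<close>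

lemma toggle_counters:
  assumes "v \<in> counters n (Suc (length ps))" "p \<in> ordered_pairs n"
  shows "toggle ps p v \<in> counters n (Suc (length ps))"
  using assms level_le[of ps p v] by (auto simp: counters_def toggle_def Transposition.transpose_def)

section \<open>The finite action and residual finiteness\<close>

text \<open>A state consists of a permutation \<open>\<pi>\<close>, which records the inverse of the permutation of the word
applied so far, and a value \<open>v\<close>. The letter \<open>s\<^sub>i\<close> acts on \<open>v\<close> like the twist of the pair to which \<open>\<pi>\<close>
carries \<open>(i, i + 1)\<close>. The permutation in the state makes an action of the whole group out of any
maps \<open>f p\<close> that satisfy the relations of the twists, even if they do not respect permutations of
the points.\<close>

fun frame_act :: "(nat \<times> nat \<Rightarrow> 'v \<Rightarrow> 'v) \<Rightarrow> vt_gen \<Rightarrow> (nat \<Rightarrow> nat) \<times> 'v \<Rightarrow> (nat \<Rightarrow> nat) \<times> 'v" where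
  "frame_act f (Rho i) (\<pi>, v) = (\<pi> \<circ> adj i, v)"
| "frame_act f (S i) (\<pi>, v) = (\<pi>, f (\<pi> i, \<pi> (Suc i)) v)"

lemma involutive_frame_act:
  assumes closed: "\<And>p v. p \<in> ordered_pairs n \<Longrightarrow> v \<in> V \<Longrightarrow> f p v \<in> V"
    and invol: "\<And>p v. p \<in> ordered_pairs n \<Longrightarrow> v \<in> V \<Longrightarrow> f p (f p v) = v"
    and comm: "\<And>p q v. p \<in> ordered_pairs n \<Longrightarrow> q \<in> ordered_pairs n \<Longrightarrow> disj_pairs p q \<Longrightarrow> v \<in> V
      \<Longrightarrow> f p (f q v) = f q (f p v)"
  shows "involutive_action (vt_gens n) (vt_rels n) ({\<pi>. \<pi> permutes {1..n}} \<times> V) (frame_act f)"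
proof
  let ?\<Sigma> = "{\<pi>. \<pi> permutes {1..n}} \<times> V"
  have adj: "\<pi> \<circ> adj i permutes {1..n}" if "\<pi> permutes {1..n}" "1 \<le> i" "i < n" for \<pi> i
    using that by (intro permutes_compose permutes_swap_id) auto
  have pair: "(\<pi> i, \<pi> (Suc i)) \<in> ordered_pairs n" if \<pi>: "\<pi> permutes {1..n}" and i: "1 \<le> i" "i < n" for \<pi> i
    using permutes_in_image[OF \<pi>, of i] permutes_in_image[OF \<pi>, of "Suc i"]
      injD[OF permutes_inj[OF \<pi>], of i "Suc i"] i
    by (auto simp: ordered_pairs_def)
  have disj: "disj_pairs (\<pi> i, \<pi> (Suc i)) (\<pi> j, \<pi> (Suc j))"
    if "\<pi> permutes {1..n}" "\<bar>int i - int j\<bar> \<ge> 2" for \<pi> i j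
    using that inj_eq[OF permutes_inj[OF that(1)]] by (auto simp: disj_pairs_def)
  show "vt_rels n \<subseteq> words (vt_gens n) \<times> words (vt_gens n)" by (rule vt_rels_words)
  show "frame_act f x \<sigma> \<in> ?\<Sigma>" if "x \<in> vt_gens n" "\<sigma> \<in> ?\<Sigma>" for x \<sigma>
    using that closed pair adj by (cases x; cases \<sigma>) auto
  show invol': "frame_act f x (frame_act f x \<sigma>) = \<sigma>" if "x \<in> vt_gens n" "\<sigma> \<in> ?\<Sigma>" for x \<sigma>
    using that invol pair by (cases x; cases \<sigma>) (auto simp: comp_assoc)
  show "run (frame_act f) u \<sigma> = run (frame_act f) v \<sigma>" if uv: "(u, v) \<in> vt_rels n" and \<sigma>: "\<sigma> \<in> ?\<Sigma>" for u v \<sigma>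
  proof -
    obtain \<pi> c where \<pi>: "\<sigma> = (\<pi>, c)" "\<pi> permutes {1..n}" "c \<in> V" using \<sigma> by auto
    from uv consider
        (ss) i where "u = [\<s> i, \<s> i]" "v = []" "1 \<le> i" "i < n"
      | (rr) i where "u = [\<rho> i, \<rho> i]" "v = []" "1 \<le> i" "i < n"
      | (s_s) i j where "u = [\<s> i, \<s> j]" "v = [\<s> j, \<s> i]" "1 \<le> i" "i < n" "1 \<le> j" "j < n" "\<bar>int i - int j\<bar> \<ge> 2"
      | (r_r) i j where "u = [\<rho> i, \<rho> j]" "v = [\<rho> j, \<rho> i]" "\<bar>int i - int j\<bar> \<ge> 2"
      | (r_s) i j where "u = [\<rho> i, \<s> j]" "v = [\<s> j, \<rho> i]" "\<bar>int i - int j\<bar> \<ge> 2"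
      | (rrr) i where "u = [\<rho> i, \<rho> (Suc i), \<rho> i]" "v = [\<rho> (Suc i), \<rho> i, \<rho> (Suc i)]"
      | (rrs) i where "u = [\<rho> i, \<rho> (Suc i), \<s> i]" "v = [\<s> (Suc i), \<rho> i, \<rho> (Suc i)]"
      unfolding vt_rels_def by fastforce
    then show ?thesis
    proof cases
      case ss
      then show ?thesis using invol'[of "S i" \<sigma>] \<sigma> by simp
    next
      case rr
      then show ?thesis using invol'[of "Rho i" \<sigma>] \<sigma> by simp
    next
      case s_s
      then show ?thesis
        using comm[OF pair[OF \<pi>(2), of i] pair[OF \<pi>(2), of j] disj[OF \<pi>(2), of i j] \<pi>(3)] \<pi>(1)
        by simp
    next
      case r_r
      then show ?thesis using adj_commute[of i j] \<pi> by (simp add: comp_assoc)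
    next
      case r_s
      have "adj i j = j" "adj i (Suc j) = Suc j"
        by (rule transpose_apply_other; use r_s(3) in linarith)+
      then show ?thesis using r_s \<pi> by simp
    next
      case rrr
      then show ?thesis using adj_braid[of i] \<pi> by (simp add: comp_assoc)
    next
      case rrs
      then show ?thesis using \<pi> by (simp add: Transposition.transpose_def)
    qed
  qed
qed

lemma run_rho_word: "run (frame_act f) (rho_word ks) (\<pi>, v) = (\<pi> \<circ> perm (rho_word (rev ks)), v)"
  by (induction ks) (simp_all add: perm_append fun_eq_iff)

context virtual_twin
begin

lemma run_twist:
  assumes "p \<in> ordered_pairs n"
  shows "run (frame_act f) (twist p) (id, v) = (id, f p v)"
proof -
  obtain ks where ks: "twist p = conj_word ks 1" "set ks \<subseteq> {1..n-1}"
    "perm (rho_word ks) 1 = fst p" "perm (rho_word ks) 2 = snd p"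
    by (rule twist_conj_word[OF assms])
  have "perm (rho_word ks) \<circ> perm (rho_word (rev ks)) = id"
    using cong_perm[OF rho_cancel[OF ks(2)]] by (simp add: perm_append)
  then show ?thesis
    using ks by (simp add: conj_word_def run_rho_word numeral_2_eq_2)
qed

lemma run_twists:
  assumes "set ps \<subseteq> ordered_pairs n"
  shows "run (frame_act f) (twists ps) (id, v) = (id, fold f ps v)"
  using assms by (induction ps rule: rev_induct) (simp_all add: twists_def run_twist)

text \<open>Among all ways to write the element as a \<open>\<rho>\<close>-word times twists, one with fewest twists has a
reduced list \<open>ps\<close>. The action built from this list carries the state \<open>(id, 0)\<close> to the inverse
permutation of the \<open>\<rho>\<close>-word and the numbers of occurrences in \<open>ps\<close>. If the state does not move,
then \<open>ps\<close> is empty and the \<open>\<rho>\<close>-word represents the identity.\<close>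

theorem moved_by_frame_act:
  assumes w: "w \<in> vt_words" and nontriv: "\<not> w \<approx> []"
  shows "\<exists>ps. involutive_action (vt_gens n) (vt_rels n)
             ({\<pi>. \<pi> permutes {1..n}} \<times> counters n (Suc (length ps))) (frame_act (toggle ps))
           \<and> run (frame_act (toggle ps)) w (id, \<lambda>_. 0) \<noteq> (id, \<lambda>_. 0)"
proof -
  define P where "P ps \<longleftrightarrow> set ps \<subseteq> ordered_pairs n
    \<and> (\<exists>ks. set ks \<subseteq> {1..n-1} \<and> w \<approx> rho_word ks @ twists ps)" for ps
  obtain ps0 where "P ps0" using semidirect_form[OF w] unfolding P_def by blast
  then obtain ps where Pps: "P ps" and least: "\<And>qs. P qs \<Longrightarrow> length ps \<le> length qs"
    using ex_has_least_nat[of P ps0 length] by blast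
  then obtain ks where ps: "set ps \<subseteq> ordered_pairs n" and ks: "set ks \<subseteq> {1..n-1}"
    and eq: "w \<approx> rho_word ks @ twists ps"
    unfolding P_def by blast
  have "reduced ps"
    unfolding reduced_def
  proof (intro allI impI, rule ccontr)
    fix A p B C
    assume dec: "ps = A @ p # B @ p # C" and "\<not> (\<exists>q\<in>set B. q \<noteq> p \<and> \<not> disj_pairs p q)"
    then have short: "twists ps \<approx> twists (A @ B @ C)"
      using twists_shorten[of A p B C] ps by blast
    have "w \<approx> rho_word ks @ twists (A @ B @ C)"
      using cong_trans[OF eq] cong_context[OF short in_words[OF ks] words_Nil] by simp
    then have "P (A @ B @ C)" using ps ks dec unfolding P_def by auto
    from least[OF this] show False using dec by simp
  qed
  let ?act = "frame_act (toggle ps)"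
  let ?\<Sigma> = "{\<pi>. \<pi> permutes {1..n}} \<times> counters n (Suc (length ps))"
  let ?\<sigma> = "(id, \<lambda>_. 0) :: (nat \<Rightarrow> nat) \<times> (nat \<times> nat \<Rightarrow> nat)"
  interpret involutive_action "vt_gens n" "vt_rels n" ?\<Sigma> ?act
    by (rule involutive_frame_act) (use toggle_counters toggle_invol toggle_commute in auto)
  have "?\<sigma> \<in> ?\<Sigma>" by (auto simp: counters_def permutes_id)
  then have "run ?act w ?\<sigma> = run ?act (rho_word ks @ twists ps) ?\<sigma>"
    using eq by (intro run_pres_cong) (simp_all add: vt_cong_def)
  also have "\<dots> = (perm (rho_word (rev ks)), count_list ps)"
    by (simp add: run_twists[OF ps] fold_toggle[OF \<open>reduced ps\<close>] run_rho_word)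
  finally have run: "run ?act w ?\<sigma> = (perm (rho_word (rev ks)), count_list ps)" .
  have "run ?act w ?\<sigma> \<noteq> ?\<sigma>"
  proof
    assume "run ?act w ?\<sigma> = ?\<sigma>"
    then have trivial: "perm (rho_word (rev ks)) = id" "count_list ps = (\<lambda>_. 0)"
      using run by simp_all
    have "ps = []" using trivial(2) by (cases ps) (auto simp: fun_eq_iff split: if_splits)
    have "perm (rho_word ks) = id"
      using cong_perm[OF rho_cancel[OF ks]] trivial(1) by (simp add: perm_append)
    then have "rho_word ks \<approx> []"
      using rho_word_faithful[of "n - 1" ks] ks cong_refl[OF words_Nil] by (cases "n - 1 < n") auto
    then have "w \<approx> []" using eq \<open>ps = []\<close> cong_trans by (simp add: twists_def)
    then show False using nontriv by simp
  qed
  then show ?thesis using involutive_action_axioms by blast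
qed

end

theorem residually_finite_virtual_twin_group: "residually_finite (virtual_twin_group n)"
  unfolding residually_finite_def
proof (intro ballI impI)
  interpret virtual_twin n .
  let ?G = "virtual_twin_group n"
  fix g assume "g \<in> carrier ?G" and "g \<noteq> \<one>\<^bsub>?G\<^esub>"
  from \<open>g \<in> _\<close> obtain w where w: "w \<in> vt_words"
      and g: "g = pres_cong (vt_gens n) (vt_rels n) `` {w}"
    unfolding virtual_twin_group_def by (rule presented_group_carrierE)
  have "\<not> w \<approx> []"
    using \<open>g \<noteq> _\<close> equiv_class_eq[OF equiv_pres_cong, of w "[]"] g
    by (auto simp: vt_cong_def virtual_twin_group_def presented_group_one)
  then obtain ps where "involutive_action (vt_gens n) (vt_rels n)
      ({\<pi>. \<pi> permutes {1..n}} \<times> counters n (Suc (length ps))) (frame_act (toggle ps))"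
    and moved: "run (frame_act (toggle ps)) w (id, \<lambda>_. 0) \<noteq> (id, \<lambda>_. 0)"
    using moved_by_frame_act[OF w] by blast
  then interpret involutive_action "vt_gens n" "vt_rels n"
    "{\<pi>. \<pi> permutes {1..n}} \<times> counters n (Suc (length ps))" "frame_act (toggle ps)"
    by blast
  show "\<exists>N. N \<lhd> ?G \<and> finite (carrier (?G Mod N)) \<and> g \<notin> N"
    unfolding virtual_twin_group_def g
  proof (rule finite_quotient_separates)
    show "finite ({\<pi>. \<pi> permutes {1..n}} \<times> counters n (Suc (length ps)))"
      by (simp add: finite_counters finite_permutations)
    show "(id, \<lambda>_. 0) \<in> {\<pi>. \<pi> permutes {1..n}} \<times> counters n (Suc (length ps))"
      by (auto simp: counters_def permutes_id)
  qed (use w moved in auto)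
qed

theorem corollary3p5:
  fixes n :: nat
  assumes "n \<ge> 2"
  shows "residually_finite (virtual_twin_group n) \<and> hopfian (virtual_twin_group n)"
proof
  show rf: "residually_finite (virtual_twin_group n)"
    by (rule residually_finite_virtual_twin_group)
  let ?A = "(\<lambda>x. pres_cong (vt_gens n) (vt_rels n) `` {[(x, True)]}) ` vt_gens n"
  show "hopfian (virtual_twin_group n)"
  proof (rule finitely_generated_residually_finite_imp_hopfian[OF _ _ _ _ rf])
    show "group (virtual_twin_group n)"
      unfolding virtual_twin_group_def by (rule group_presented_group)
    show "finite ?A" by (simp add: vt_gens_def)
    show "?A \<subseteq> carrier (virtual_twin_group n)"
      by (auto simp: virtual_twin_group_def intro: presented_group_carrierI)
    show "generate (virtual_twin_group n) ?A = carrier (virtual_twin_group n)"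
      unfolding virtual_twin_group_def by (rule generate_presented_group)
  qed
qed

end
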